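(* Let $t$ be a positive integer, $\mu$ a $t$-core partition and $0\le k\le t-1$. For each $0\le i\le t-1$ let $i'$ be the integer with $0\le i'\le t-1$ and $i-i'\equiv k\pmod t$. Then for every nonnegative integer $n$, $$\sum_{\substack{\lambda_{t\text{-core}}=\mu\\ |\lambda|-|\mu|=nt}}F_{\lambda/\mu}G_\lambda\sum_{\substack{\square\in\lambda\\ c_\square\equiv k\ (\mathrm{mod}\ t)}}c_\square^2=t\binom n2+\frac1t\sum_{i=0}^{t-1}(b_i-i')^2\,n+\sum_{\substack{\square\in\mu\\ c_\square\equiv k\ (\mathrm{mod}\ t)}}c_\square^2.$$
   Context: Partitions are identified with Young diagrams (box $(i,j)$ in row $i$, column $j$; content $c_\square=j-i$); $\mathcal H(\lambda)$ is the multiset of hook lengths (for a box: boxes to its right in its row, plus below it, plus one). A $t$-core has no hook length divisible by $t$. The 01-sequence $(z_j)_{j\in\mathbb Z}$: traverse the boundary of the Young diagram from the bottom (infinite vertical ray below the first column) to the right (infinite horizontal ray right of the first row), labelling vertical edges $0$ and horizontal edges $1$, indexed so that $\#\{j\ge0:z_j=0\}=\#\{j<0:z_j=1\}$. Adding (resp. removing) a $t$-hook exchanges some $z_j=0,z_{j+t}=1$ into $1,0$ (resp. the reverse); $\lambda\ge_t\mu$ means $\lambda$ is obtained from $\mu$ by adding $t$-hooks; the $t$-core $\lambda_{t\text{-core}}$ is obtained by removing $t$-hooks until impossible. $F_{\lambda/\mu}$: $F_{\mu/\mu}=1$, $F_{\lambda/\mu}=\sum F_{\lambda^-/\mu}$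 over $\lambda\ge_t\lambda^-\ge_t\mu$ with $|\lambda|-|\lambda^-|=t$. $G_\lambda=1/\prod_{h\in\mathcal H(\lambda),\,t\mid h}h$. For the $t$-core $\mu$ with 01-sequence $(z_{\mu,j})$: $b_i=\min\{j: j\equiv i\pmod t,\ z_{\mu,j}=1\}$. *)

theory Defs
  imports Complex_Main "HOL-Library.Multiset" "HOL-Number_Theory.Cong"
begin

definition is_partition :: "nat list \<Rightarrow> bool" where
  "is_partition \<nu> \<longleftrightarrow> sorted_wrt (\<ge>) \<nu> \<and> 0 \<notin> set \<nu>"

text \<open>Boxes are pairs (row, column), both counted from 1, with rows numbered downwards.\<close>

definition diagram :: "nat list \<Rightarrow> (nat \<times> nat) set" where
  "diagram \<nu> = {(i, j). 1 \<le> i \<and> i \<le> length \<nu> \<and> 1 \<le> j \<and> j \<le> \<nu> ! (i - 1)}"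

definition content :: "nat \<times> nat \<Rightarrow> int" where
  "content b = int (snd b) - int (fst b)"

definition hook_length :: "nat list \<Rightarrow> nat \<times> nat \<Rightarrow> nat" where
  "hook_length \<nu> b =
     card {j. (fst b, j) \<in> diagram \<nu> \<and> snd b < j}
   + card {i. (i, snd b) \<in> diagram \<nu> \<and> fst b < i} + 1"

definition hook_lengths :: "nat list \<Rightarrow> nat multiset" where
  "hook_lengths \<nu> = image_mset (hook_length \<nu>) (mset_set (diagram \<nu>))"

definition is_t_core :: "nat \<Rightarrow> nat list \<Rightarrow> bool" where
  "is_t_core t \<nu> \<longleftrightarrow> is_partition \<nu> \<and> (\<forall>h \<in># hook_lengths \<nu>. \<not> t dvd h)"

text \<open>
  The lattice point with \<open>r\<close> rows above it and \<open>c\<close> columns to its left lies on the boundary of the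
  diagram (extended by the two infinite rays) iff the box to its upper left is in the diagram
  or does not exist, and the box to its lower right is not in the diagram.
\<close>

definition boundary_point :: "nat list \<Rightarrow> nat \<times> nat \<Rightarrow> bool" where
  "boundary_point \<nu> q \<longleftrightarrow>
     (fst q = 0 \<or> snd q = 0 \<or> q \<in> diagram \<nu>) \<and> (Suc (fst q), Suc (snd q)) \<notin> diagram \<nu>"

text \<open>
  The path \<open>p\<close> traverses the boundary from the bottom to the right; edge \<open>j\<close> joins \<open>p j\<close> to
  \<open>p (j + 1)\<close> and carries the label \<open>z j\<close>, which is 0 for a step upwards and 1 for a step to
  the right.
\<close>

definition boundary_traversal :: "nat list \<Rightarrow> (int \<Rightarrow> nat) \<Rightarrow> (int \<Rightarrow> nat \<times> nat) \<Rightarrow> bool" where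
  "boundary_traversal \<nu> z p \<longleftrightarrow>
     (\<forall>j. boundary_point \<nu> (p j) \<and>
        (z j = 0 \<and> fst (p j) = fst (p (j + 1)) + 1 \<and> snd (p (j + 1)) = snd (p j) \<or>
         z j = 1 \<and> fst (p (j + 1)) = fst (p j) \<and> snd (p (j + 1)) = snd (p j) + 1))"

definition is_seq01 :: "nat list \<Rightarrow> (int \<Rightarrow> nat) \<Rightarrow> bool" where
  "is_seq01 \<nu> z \<longleftrightarrow> (\<exists>p. boundary_traversal \<nu> z p) \<and>
     card {j. 0 \<le> j \<and> z j = 0} = card {j. j < 0 \<and> z j = 1}"

definition seq01 :: "nat list \<Rightarrow> int \<Rightarrow> nat" where
  "seq01 \<nu> = (THE z. is_seq01 \<nu> z)"

definition adds_hook :: "nat \<Rightarrow> nat list \<Rightarrow> nat list \<Rightarrow> bool" where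
  "adds_hook t \<kappa> \<nu> \<longleftrightarrow> is_partition \<kappa> \<and> is_partition \<nu> \<and>
     (\<exists>j. seq01 \<kappa> j = 0 \<and> seq01 \<kappa> (j + int t) = 1 \<and>
          seq01 \<nu> = (seq01 \<kappa>)(j := 1, j + int t := 0))"

definition hook_ge :: "nat \<Rightarrow> nat list \<Rightarrow> nat list \<Rightarrow> bool" where
  "hook_ge t \<nu> \<kappa> \<longleftrightarrow> (adds_hook t)\<^sup>*\<^sup>* \<kappa> \<nu>"

definition has_t_core :: "nat \<Rightarrow> nat list \<Rightarrow> nat list \<Rightarrow> bool" where
  "has_t_core t \<nu> \<kappa> \<longleftrightarrow> hook_ge t \<nu> \<kappa> \<and> (\<nexists>\<kappa>'. adds_hook t \<kappa>' \<kappa>)"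

text \<open>
  The condition \<open>0 < t\<close> only serves termination.
\<close>

function F :: "nat \<Rightarrow> nat list \<Rightarrow> nat list \<Rightarrow> nat" where
  "F t \<nu> \<mu> =
     (if \<nu> = \<mu> then 1
      else (\<Sum>\<kappa> \<in> {\<kappa>. 0 < t \<and> hook_ge t \<nu> \<kappa> \<and> hook_ge t \<kappa> \<mu> \<and> sum_list \<nu> = sum_list \<kappa> + t}.
              F t \<kappa> \<mu>))"
  by auto
termination
  by (relation "measure (\<lambda>(t, \<nu>, \<mu>). sum_list \<nu>)") auto

declare F.simps [simp del]

definition G :: "nat \<Rightarrow> nat list \<Rightarrow> real" where
  "G t \<nu> = 1 / real (\<Prod>h \<in># filter_mset (\<lambda>h. t dvd h) (hook_lengths \<nu>). h)"

definition b :: "nat \<Rightarrow> nat list \<Rightarrow> nat \<Rightarrow> int" where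
  "b t \<mu> i = (LEAST j. [j = int i] (mod int t) \<and> seq01 \<mu> j = 1)"


subsection \<open>The 01-sequence of a partition is well defined\<close>

definition row :: "nat list \<Rightarrow> nat \<Rightarrow> nat" where
  "row \<nu> i = (if 1 \<le> i \<and> i \<le> length \<nu> then \<nu> ! (i - 1) else 0)"

lemma row_antimono:
  assumes "is_partition \<nu>" "1 \<le> i" "i \<le> i'"
  shows "row \<nu> i' \<le> row \<nu> i"
proof (cases "i = i' \<or> \<not> i' \<le> length \<nu>")
  case False
  then have "i - 1 < i' - 1" "i' - 1 < length \<nu>" using assms by auto
  then have "\<nu> ! (i - 1) \<ge> \<nu> ! (i' - 1)"
    using assms(1) unfolding is_partition_def by (metis sorted_wrt_nth_less)
  then show ?thesis using False assms by (simp add: row_def)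
qed (auto simp: row_def)

lemma boundary_point_row:
  "boundary_point \<nu> (r, c) \<longleftrightarrow> (r = 0 \<or> c \<le> row \<nu> r) \<and> row \<nu> (Suc r) \<le> c"
  by (auto simp: boundary_point_def diagram_def row_def)

lemma boundary_point_unique:
  assumes "is_partition \<nu>" "boundary_point \<nu> q" "boundary_point \<nu> q'" "content q = content q'"
  shows "q = q'"
proof -
  have *: False if "boundary_point \<nu> (r, c)" "boundary_point \<nu> (r', c')" "r < r'"
    "content (r, c) = content (r', c')" for r c r' c'
    using that row_antimono[OF assms(1), of "Suc r" r']
    by (auto simp: boundary_point_row content_def)
  obtain r c r' c' where q: "q = (r, c)" "q' = (r', c')" by (cases q, cases q')
  have "\<not> r < r'" "\<not> r' < r" using *[of r c r' c'] *[of r' c' r c] assms q by auto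
  then show ?thesis using assms(4) q by (auto simp: content_def)
qed

lemma boundary_point_exists:
  "\<exists>q. boundary_point \<nu> q \<and> content q = s"
proof -
  define P where "P r \<longleftrightarrow> int (row \<nu> (Suc r)) - int (Suc r) < s" for r
  have "P (length \<nu> + nat (- s))" by (simp add: P_def row_def)
  then have 1: "P (LEAST r. P r)" by (rule LeastI)
  define r where "r = (LEAST r. P r)"
  have 2: "P r" using 1 r_def by simp
  have 3: "r = 0 \<or> \<not> P (r - 1)"
    using not_less_Least[of "r - 1" P] r_def by auto
  define c where "c = nat (int r + s)"
  have "int c = int r + s" using 2 by (simp add: c_def P_def)
  moreover have "r = 0 \<or> int (row \<nu> r) - int r \<ge> s"
    using 3 by (cases r) (auto simp: P_def)
  ultimately have "boundary_point \<nu> (r, c)" "content (r, c) = s"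
    using 2 by (auto simp: boundary_point_row P_def content_def)
  then show ?thesis by blast
qed

lemma card_steps:
  fixes f :: "int \<Rightarrow> nat"
  assumes "\<And>j. f j = f (j + 1) + (if P j then 1 else 0)" "\<And>j. j \<ge> N \<Longrightarrow> f j = 0"
  shows "finite {j. s \<le> j \<and> P j} \<and> card {j. s \<le> j \<and> P j} = f s"
proof (induction "nat (N - s)" arbitrary: s)
  case 0
  have "\<not> P j" if "s \<le> j" for j
  proof
    assume "P j"
    then have "f j \<noteq> 0" using assms(1)[of j] by (simp only: if_True)
    then show False using assms(2)[of j] that 0 by simp
  qed
  then have "{j. s \<le> j \<and> P j} = {}" by blast
  moreover have "f s = 0" using 0 assms(2) by simp
  ultimately show ?case by (simp only: card.empty finite.emptyI)
next
  case (Suc m)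
  then have IH: "finite {j. s + 1 \<le> j \<and> P j}" "card {j. s + 1 \<le> j \<and> P j} = f (s + 1)"
    using Suc.hyps(1)[of "s + 1"] Suc.hyps(2) by simp_all
  have "{j. s \<le> j \<and> P j} = (if P s then {s} else {}) \<union> {j. s + 1 \<le> j \<and> P j}"
    by (auto simp: order_le_less)
  moreover have "f s = f (s + 1) + (if P s then 1 else 0)" by (rule assms(1))
  ultimately show ?case using IH by (cases "P s") simp_all
qed

lemma traversal_content:
  assumes "boundary_traversal \<nu> z p"
  shows "content (p j) = j + content (p 0)"
proof -
  have step: "content (p (i + 1)) = content (p i) + 1" for i
    using assms[unfolded boundary_traversal_def, rule_format, of i] by (auto simp: content_def)
  show ?thesis
  proof (induction j rule: int_induct[where k = 0])
    case (step2 i)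
    then show ?case using step[of "i - 1"] by simp
  qed (simp_all add: step)
qed

lemma traversal_counts:
  assumes "is_partition \<nu>" "boundary_traversal \<nu> z p"
  shows "finite {j. 0 \<le> j \<and> z j = 0} \<and> card {j. 0 \<le> j \<and> z j = 0} = fst (p 0)"
    and "finite {j. j < 0 \<and> z j = 1} \<and> card {j. j < 0 \<and> z j = 1} = snd (p 0)"
proof -
  note tr = assms(2)[unfolded boundary_traversal_def, rule_format]
  have pt: "(fst (p j) = 0 \<or> snd (p j) \<le> row \<nu> (fst (p j))) \<and> row \<nu> (Suc (fst (p j))) \<le> snd (p j)"
    for j
    using tr[of j] boundary_point_row[of \<nu> "fst (p j)" "snd (p j)"] by simp
  have ct: "int (snd (p j)) - int (fst (p j)) = j + content (p 0)" for j
    using traversal_content[OF assms(2), of j] by (simp add: content_def)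
  show "finite {j. 0 \<le> j \<and> z j = 0} \<and> card {j. 0 \<le> j \<and> z j = 0} = fst (p 0)"
  proof (rule card_steps[where N = "int (row \<nu> 1) - content (p 0)"])
    fix j show "fst (p j) = fst (p (j + 1)) + (if z j = 0 then 1 else 0)"
      using tr[of j] by auto
  next
    fix j assume j: "j \<ge> int (row \<nu> 1) - content (p 0)"
    show "fst (p j) = 0"
    proof (rule ccontr)
      assume "fst (p j) \<noteq> 0"
      then have "snd (p j) \<le> row \<nu> 1"
        using pt[of j] row_antimono[OF assms(1), of 1 "fst (p j)"]
        by auto
      then show False using ct[of j] j \<open>fst (p j) \<noteq> 0\<close> by linarith
    qed
  qed
  have "finite {j. 1 \<le> j \<and> z (- j) = 1} \<and> card {j. 1 \<le> j \<and> z (- j) = 1} = snd (p (1 - 1))"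
  proof (rule card_steps[where N = "int (length \<nu>) + content (p 0) + 2" and f = "\<lambda>j. snd (p (1 - j))"])
    fix j show "snd (p (1 - j)) = snd (p (1 - (j + 1))) + (if z (- j) = 1 then 1 else 0)"
      using tr[of "- j"] by (auto simp: algebra_simps)
  next
    fix j :: int assume j: "j \<ge> int (length \<nu>) + content (p 0) + 2"
    show "snd (p (1 - j)) = 0"
    proof (rule ccontr)
      assume *: "snd (p (1 - j)) \<noteq> 0"
      then have "fst (p (1 - j)) \<le> length \<nu>"
        using pt[of "1 - j"] by (auto simp: row_def split: if_splits)
      then show False using ct[of "1 - j"] j * by linarith
    qed
  qed
  moreover have "{j. j < 0 \<and> z j = 1} = uminus ` {j. 1 \<le> j \<and> z (- j) = 1}"
  proof (intro set_eqI iffI)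
    fix j assume "j \<in> {j. j < 0 \<and> z j = 1}"
    then show "j \<in> uminus ` {j. 1 \<le> j \<and> z (- j) = 1}"
      by (intro image_eqI[of _ _ "- j"]) auto
  qed auto
  ultimately show "finite {j. j < 0 \<and> z j = 1} \<and> card {j. j < 0 \<and> z j = 1} = snd (p 0)"
    by (simp add: card_image)
qed

lemma seq01_ex1:
  assumes "is_partition \<nu>"
  shows "\<exists>!z. is_seq01 \<nu> z"
proof -
  obtain p where p: "\<And>s. boundary_point \<nu> (p s)" "\<And>s. content (p s) = s"
    using boundary_point_exists by metis
  define z where "z j = (if 1 \<le> fst (p j) \<and> row \<nu> (fst (p j)) = snd (p j) then 0 else 1 :: nat)" for j
  have tr: "boundary_traversal \<nu> z p"
    unfolding boundary_traversal_def
  proof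
    fix j
    obtain r c where rc: "p j = (r, c)" by (cases "p j")
    have bp: "boundary_point \<nu> (r, c)" and ct: "content (r, c) = j" using p rc by metis+
    show "boundary_point \<nu> (p j) \<and>
        (z j = 0 \<and> fst (p j) = fst (p (j + 1)) + 1 \<and> snd (p (j + 1)) = snd (p j) \<or>
         z j = 1 \<and> fst (p (j + 1)) = fst (p j) \<and> snd (p (j + 1)) = snd (p j) + 1)"
    proof (cases "1 \<le> r \<and> row \<nu> r = c")
      case True
      have "boundary_point \<nu> (r - 1, c)"
        using True row_antimono[OF assms, of "r - 1" r]
        by (cases "r = 1") (auto simp: boundary_point_row)
      moreover have "content (r - 1, c) = j + 1" using ct True by (auto simp: content_def)
      ultimately have "p (j + 1) = (r - 1, c)"
        using boundary_point_unique[OF assms] p by metis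
      then show ?thesis using True rc p(1)[of j] by (simp add: z_def)
    next
      case False
      have "boundary_point \<nu> (r, c + 1)"
        using False bp by (auto simp: boundary_point_row)
      moreover have "content (r, c + 1) = j + 1" using ct by (auto simp: content_def)
      ultimately have "p (j + 1) = (r, c + 1)"
        using boundary_point_unique[OF assms] p by metis
      then show ?thesis using False rc p(1)[of j] by (auto simp: z_def)
    qed
  qed
  have "fst (p 0) = snd (p 0)" using p(2)[of 0] by (simp add: content_def)
  then have "is_seq01 \<nu> z"
    using tr traversal_counts[OF assms tr] unfolding is_seq01_def by auto
  moreover have "z' = z" if z': "is_seq01 \<nu> z'" for z'
  proof
    fix j
    obtain p' where p': "boundary_traversal \<nu> z' p'"
      and bal: "card {j. 0 \<le> j \<and> z' j = 0} = card {j. j < 0 \<and> z' j = 1}"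
      using z' unfolding is_seq01_def by blast
    have "content (p' 0) = 0"
      using bal traversal_counts[OF assms p'] by (simp add: content_def)
    then have "content (p' i) = content (p i)" for i
      using traversal_content[OF p', of i] p(2)[of i] by simp
    then have "p' i = p i" for i
      using boundary_point_unique[OF assms] p(1) p' unfolding boundary_traversal_def by blast
    then have "p' = p" by blast
    then show "z' j = z j"
      using p'[unfolded boundary_traversal_def, rule_format, of j]
        tr[unfolded boundary_traversal_def, rule_format, of j] by auto
  qed
  ultimately show ?thesis by blast
qed

end

(*
  Read the zeros of the 01-sequence as beads. Adding a t-hook moves a bead from x to x + t, and the
  new boxes have contents x + 1, ..., x + t; exactly one of these is congruent to k, namely
  x + t - i' where i is the residue of x.
  The hook lengths divisible by t are the differences of a bead and a lower gap in the same residue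
  class. Hence, when the bead moves, G changes by the factor P x / t, where the P x are the
  partial fraction coefficients of prod (X - y + t) / prod (X - y) over the beads y of that class
  above a cutoff (the lowest one is omitted in the numerator).
  The power moments of the P x show that G nu' / G nu are transition probabilities, that a step
  happens in each class with probability 1/t, that x + t then has mean b_i, and that its variance is t
  times the displacement of the beads of the class from their position in the core. These
  displacements add up to n t, so the expected contribution of step n + 1 is
  (1/t) sum (b_i - i')^2 + t n, and summation over the steps gives the claim.
*)

theory Submission
  imports Defs
begin

subsection \<open>Beads\<close>

text \<open>The obstacle is that the beads of a residue class go on downwards forever, so neither a
  product over the class nor the sum of its positions makes sense as it stands. A cutoff without
  gaps below it makes both finite. If N beads of the class are kept, the rational function has N
  poles and N - 1 zeros and behaves like 1/X at infinity; the coefficients of its expansion there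
  are the moments of the P x, so these depend only on power sums of the beads. Up to the second
  moment, only N and the sum of the N positions enter. N does not change when beads move within
  their class, so it can be read off from the core, where it determines b_i. The sum of all kept
  positions grows by t in each step, whichever bead moves. Hence the expected contribution of a step
  depends only on the number of hooks added before, although their distribution over the classes
  varies: only the total displacement counts. The term t * binom(n, 2) is the sum of t * m over m <
  n.\<close>

lemma card_exchange:
  assumes "finite S" "x \<in> S" "y \<notin> S"
  shows "card (insert y (S - {x})) = card S"
  using assms card.remove[of S x] by simp

text \<open>The diagram depends on the beads through the number of them at or above each threshold
  \<open>c\<close>; a move is noticed exactly by the thresholds that the bead crosses.\<close>

lemma card_ge_exchange:
  fixes x c :: int
  assumes fin: "finite {y \<in> Z. c \<le> y}" and x: "x \<in> Z" "x + int t \<notin> Z"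
  shows "card {y \<in> insert (x + int t) (Z - {x}). c \<le> y} =
    card {y \<in> Z. c \<le> y} + (if x < c \<and> c \<le> x + int t then 1 else 0)"
proof -
  consider "c \<le> x" | "x < c" "c \<le> x + int t" | "x + int t < c" by linarith
  then show ?thesis
  proof cases
    case 1
    then have "{y \<in> insert (x + int t) (Z - {x}). c \<le> y} =
      insert (x + int t) ({y \<in> Z. c \<le> y} - {x})" by auto
    then show ?thesis using 1 x card_exchange[OF fin, of x "x + int t"] by simp
  next
    case 2
    then have "{y \<in> insert (x + int t) (Z - {x}). c \<le> y} =
      insert (x + int t) {y \<in> Z. c \<le> y}" by auto
    then show ?thesis using 2 x fin by simp
  next
    case 3
    then have "{y \<in> insert (x + int t) (Z - {x}). c \<le> y} = {y \<in> Z. c \<le> y}" by auto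
    then show ?thesis using 3 by simp
  qed
qed

text \<open>The zeros of the 01-sequence: the vertical edge at the end of row \<open>i\<close> starts at a
  boundary point of content \<open>row \<nu> i - i\<close>.\<close>

definition beads :: "nat list \<Rightarrow> int set" where
  "beads \<nu> = (\<lambda>i. int (row \<nu> i) - int i) ` {1..}"

lemma beadI: "1 \<le> i \<Longrightarrow> int (row \<nu> i) - int i \<in> beads \<nu>"
  by (auto simp: beads_def)

lemma seq01_eq:
  assumes "is_partition \<nu>"
  shows "seq01 \<nu> j = (if j \<in> beads \<nu> then 0 else 1)"
proof -
  have "is_seq01 \<nu> (seq01 \<nu>)"
    unfolding seq01_def by (rule theI'[OF seq01_ex1[OF assms]])
  then obtain p where p: "boundary_traversal \<nu> (seq01 \<nu>) p"
    and bal: "card {j. 0 \<le> j \<and> seq01 \<nu> j = 0} = card {j. j < 0 \<and> seq01 \<nu> j = 1}"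
    unfolding is_seq01_def by blast
  \<comment> \<open>The balance condition on the labels is what pins the indexing: the index of an
    edge is the content of its starting point.\<close>
  have "content (p 0) = 0"
    using bal traversal_counts[OF assms p] by (simp add: content_def)
  then have ct: "content (p j) = j" using traversal_content[OF p, of j] by simp
  obtain r c where rc: "p j = (r, c)" by (cases "p j")
  have j: "j = int c - int r" using ct rc by (simp add: content_def)
  note tr = p[unfolded boundary_traversal_def, rule_format]
  have bp: "boundary_point \<nu> (r, c)" and bp': "boundary_point \<nu> (p (j + 1))"
    using tr[of j] tr[of "j + 1"] rc by auto
  consider "seq01 \<nu> j = 0" "1 \<le> r" "p (j + 1) = (r - 1, c)"
    | "seq01 \<nu> j = 1" "p (j + 1) = (r, c + 1)"
    using tr[of j] rc by (cases "p (j + 1)") auto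
  then show ?thesis
  proof cases
    case 1
    then have "row \<nu> r = c" using bp bp' by (auto simp: boundary_point_row)
    then have "j \<in> beads \<nu>" using 1 j by (auto simp: beads_def)
    then show ?thesis using 1 by simp
  next
    case 2
    then have c: "r = 0 \<or> c + 1 \<le> row \<nu> r" "row \<nu> (Suc r) \<le> c"
      using bp bp' by (auto simp: boundary_point_row)
    have "j \<noteq> int (row \<nu> i) - int i" if "1 \<le> i" for i
    proof (cases "i \<le> r")
      case True
      then have "row \<nu> r \<le> row \<nu> i" using row_antimono[OF assms that] by blast
      then show ?thesis using c j True that by auto
    next
      case False
      then have "row \<nu> i \<le> row \<nu> (Suc r)" using row_antimono[OF assms, of "Suc r" i] by simp
      then show ?thesis using c j False by auto
    qed
    then show ?thesis using 2 by (auto simp: beads_def)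
  qed
qed

section \<open>Ordering and counting beads\<close>

lemma bead_less:
  assumes "is_partition \<nu>" "1 \<le> i" "i < i'"
  shows "int (row \<nu> i') - int i' < int (row \<nu> i) - int i"
  using row_antimono[OF assms(1,2), of i'] assms(3) by simp

lemma bead_less_iff:
  assumes "is_partition \<nu>" "1 \<le> i" "1 \<le> i'"
  shows "int (row \<nu> i') - int i' < int (row \<nu> i) - int i \<longleftrightarrow> i < i'"
  using bead_less[OF assms(1,2), of i'] bead_less[OF assms(1,3), of i]
  by (cases i i' rule: linorder_cases) auto

lemma inj_bead:
  assumes "is_partition \<nu>"
  shows "inj_on (\<lambda>i. int (row \<nu> i) - int i) {1..}"
proof (rule inj_onI)
  fix x y assume "x \<in> {1..}" "y \<in> {1..}" "int (row \<nu> x) - int x = int (row \<nu> y) - int y"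
  then show "x = y"
    using bead_less[OF assms, of x y] bead_less[OF assms, of y x] by (cases x y rule: linorder_cases) auto
qed

lemma beads_below: "j < - int (length \<nu>) \<Longrightarrow> j \<in> beads \<nu>"
  unfolding beads_def by (rule image_eqI[of _ _ "nat (- j)"]) (auto simp: row_def)

lemma beads_bounded:
  assumes "is_partition \<nu>" "x \<in> beads \<nu>"
  shows "x < int (row \<nu> 1)"
  using assms row_antimono[OF assms(1), of 1] by (fastforce simp: beads_def)

lemma finite_beads_ge:
  assumes "is_partition \<nu>"
  shows "finite {x \<in> beads \<nu>. c \<le> x}"
  by (rule finite_subset[of _ "{c..int (row \<nu> 1)}"]) (use beads_bounded[OF assms] in force)+

text \<open>Beads strictly decrease with the row, so the bead of row \<open>i\<close> is the
  \<open>i\<close>-th largest. Counting beads therefore recovers the diagram, diagonal by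
  diagonal.\<close>

lemma bead_ge_iff:
  assumes "is_partition \<nu>" "1 \<le> i"
  shows "c \<le> int (row \<nu> i) - int i \<longleftrightarrow> i \<le> card {x \<in> beads \<nu>. c \<le> x}"
proof
  let ?\<beta> = "\<lambda>i. int (row \<nu> i) - int i"
  have inj: "inj_on ?\<beta> {1..<n}" for n
    using inj_bead[OF assms(1)] by (rule inj_on_subset) auto
  {
    assume c: "c \<le> ?\<beta> i"
    have "?\<beta> ` {1..<Suc i} \<subseteq> {x \<in> beads \<nu>. c \<le> x}"
    proof -
      have "c \<le> ?\<beta> l" if "1 \<le> l" "l \<le> i" for l
        using c bead_less[OF assms(1) that(1), of i] that(2) by (cases "l = i") auto
      then show ?thesis by (auto simp: beads_def)
    qed
    from card_mono[OF finite_beads_ge[OF assms(1)] this]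
    show "i \<le> card {x \<in> beads \<nu>. c \<le> x}" using inj by (simp add: card_image)
  next
    assume *: "i \<le> card {x \<in> beads \<nu>. c \<le> x}"
    show "c \<le> ?\<beta> i"
    proof (rule ccontr)
      assume c: "\<not> c \<le> ?\<beta> i"
      have "{x \<in> beads \<nu>. c \<le> x} \<subseteq> ?\<beta> ` {1..<i}"
      proof
        fix x assume "x \<in> {x \<in> beads \<nu>. c \<le> x}"
        then obtain l where l: "1 \<le> l" "x = ?\<beta> l" "c \<le> x" by (auto simp: beads_def)
        then have "l < i" using c bead_less_iff[OF assms(1) l(1) assms(2)] by simp
        then show "x \<in> ?\<beta> ` {1..<i}" using l by auto
      qed
      from card_mono[OF _ this] have "card {x \<in> beads \<nu>. c \<le> x} \<le> i - 1"
        using inj by (simp add: card_image)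
      then show False using * assms(2) by simp
    qed
  }
qed

lemma diagram_row: "(i, j) \<in> diagram \<nu> \<longleftrightarrow> 1 \<le> i \<and> 1 \<le> j \<and> j \<le> row \<nu> i"
  by (auto simp: diagram_def row_def)

lemma diagram_beads:
  assumes "is_partition \<nu>"
  shows "(i, j) \<in> diagram \<nu> \<longleftrightarrow>
    1 \<le> i \<and> 1 \<le> j \<and> i \<le> card {x \<in> beads \<nu>. int j - int i \<le> x}"
  using bead_ge_iff[OF assms, of i "int j - int i"] by (auto simp: diagram_row)

lemma diagram_inj:
  assumes "is_partition \<nu>" "is_partition \<kappa>" "diagram \<nu> = diagram \<kappa>"
  shows "\<nu> = \<kappa>"
proof -
  have row: "row \<nu> i = row \<kappa> i" if "1 \<le> i" for i
  proof -
    have "{j. 1 \<le> j \<and> j \<le> row \<nu> i} = {j. 1 \<le> j \<and> j \<le> row \<kappa> i}"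
      using assms(3) that diagram_row[of i _ \<nu>] diagram_row[of i _ \<kappa>] by blast
    then have "{1..row \<nu> i} = {1..row \<kappa> i}" by (simp add: atLeastAtMost_def atLeast_def atMost_def Collect_conj_eq)
    from arg_cong[OF this, of card] show ?thesis by simp
  qed
  \<comment> \<open>\<open>row\<close> is padded with zeros beyond the list; as no part is zero, the
    length is recovered from where the zeros begin.\<close>
  have len: "length \<nu> = (LEAST l. \<forall>i>l. row \<nu> i = 0)" if "is_partition \<nu>" for \<nu>
  proof (rule sym, rule Least_equality)
    fix l assume l: "\<forall>i>l. row \<nu> i = 0"
    show "length \<nu> \<le> l"
    proof (rule ccontr)
      assume "\<not> length \<nu> \<le> l"
      then have "\<nu> ! (length \<nu> - 1) = 0" "length \<nu> > 0"
        using l[rule_format, of "length \<nu>"] by (auto simp: row_def split: if_splits)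
      then show False using that nth_mem[of "length \<nu> - 1" \<nu>] by (simp add: is_partition_def)
    qed
  qed (simp add: row_def)
  have "(\<forall>i>l. row \<nu> i = 0) \<longleftrightarrow> (\<forall>i>l. row \<kappa> i = 0)" for l using row by force
  then have "length \<nu> = length \<kappa>" using len assms(1,2) by simp
  moreover have "\<nu> ! i = \<kappa> ! i" if "i < length \<nu>" for i
    using row[of "Suc i"] that \<open>length \<nu> = length \<kappa>\<close> by (simp add: row_def)
  ultimately show ?thesis by (simp add: list_eq_iff_nth_eq)
qed

lemma beads_inj:
  assumes "is_partition \<nu>" "is_partition \<kappa>" "beads \<nu> = beads \<kappa>"
  shows "\<nu> = \<kappa>"
  by (rule diagram_inj[OF assms(1,2)])
     (auto simp: diagram_beads[OF assms(1)] diagram_beads[OF assms(2)] assms(3))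

lemma adds_hook_iff:
  "adds_hook t \<kappa> \<nu> \<longleftrightarrow> is_partition \<kappa> \<and> is_partition \<nu> \<and>
     (\<exists>x. x \<in> beads \<kappa> \<and> x + int t \<notin> beads \<kappa> \<and>
          beads \<nu> = insert (x + int t) (beads \<kappa> - {x}))"
proof (cases "is_partition \<kappa> \<and> is_partition \<nu>")
  case True
  then have eq: "seq01 \<kappa> = (\<lambda>j. if j \<in> beads \<kappa> then 0 else 1)"
    "seq01 \<nu> = (\<lambda>j. if j \<in> beads \<nu> then 0 else 1)"
    by (auto simp: seq01_eq)
  have "seq01 \<kappa> x = 0 \<and> seq01 \<kappa> (x + int t) = 1 \<and>
      seq01 \<nu> = (seq01 \<kappa>)(x := 1, x + int t := 0)
    \<longleftrightarrow> x \<in> beads \<kappa> \<and> x + int t \<notin> beads \<kappa> \<and> beads \<nu> = insert (x + int t) (beads \<kappa> - {x})" for x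
  proof -
    have "seq01 \<nu> y = ((seq01 \<kappa>)(x := 1, x + int t := 0)) y \<longleftrightarrow>
        (y \<in> beads \<nu> \<longleftrightarrow> y \<in> insert (x + int t) (beads \<kappa> - {x}))" for y
      by (simp add: eq)
    then show ?thesis unfolding fun_eq_iff set_eq_iff by (simp add: eq)
  qed
  then show ?thesis using True by (simp add: adds_hook_def)
qed (auto simp: adds_hook_def)

section \<open>Adding a hook: contents of the new boxes, existence of the new partition\<close>

lemma finite_diagram: "finite (diagram \<nu>)"
  and card_diagram: "card (diagram \<nu>) = sum_list \<nu>"
proof -
  have *: "diagram \<nu> = Sigma {1..length \<nu>} (\<lambda>i. {1..\<nu> ! (i - 1)})"
    by (auto simp: diagram_def)
  show "finite (diagram \<nu>)" unfolding * by simp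
  have "card (diagram \<nu>) = (\<Sum>i = 1..length \<nu>. \<nu> ! (i - 1))" unfolding * by simp
  also have "\<dots> = (\<Sum>i<length \<nu>. \<nu> ! i)"
    by (rule sum.reindex_bij_witness[of _ Suc "\<lambda>i. i - 1"]) auto
  finally show "card (diagram \<nu>) = sum_list \<nu>" by (simp add: sum_list_sum_nth atLeast0LessThan)
qed

text \<open>The boxes of content \<open>c\<close> are counted by the beads that are at least
  \<open>c\<close>, so a diagonal gains a box, and only one, exactly when the moving bead crosses
  it. The general \<open>g\<close> covers both the size (constant 1) and the squared
  contents.\<close>

lemma sum_content_add_hook:
  fixes g :: "int \<Rightarrow> 'a :: comm_monoid_add"
  assumes "is_partition \<kappa>" "is_partition \<nu>" "x \<in> beads \<kappa>" "x + int t \<notin> beads \<kappa>"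
    "beads \<nu> = insert (x + int t) (beads \<kappa> - {x})"
  shows "(\<Sum>q \<in> diagram \<nu>. g (content q)) =
    (\<Sum>q \<in> diagram \<kappa>. g (content q)) + (\<Sum>c \<in> {x + 1..x + int t}. g c)"
proof -
  define r where "r c = card {y \<in> beads \<kappa>. c \<le> y}" for c
  have r: "card {y \<in> beads \<nu>. c \<le> y} = r c + (if x < c \<and> c \<le> x + int t then 1 else 0)" for c
    unfolding r_def assms(5)
    by (rule card_ge_exchange) (use assms(3,4) finite_beads_ge[OF assms(1)] in simp_all)
  have nn: "0 \<le> int (r c) + c" for c
  proof (cases "0 \<le> c")
    case False
    then have "nat (- c) \<le> r c"
      using bead_ge_iff[OF assms(1), of "nat (- c)" c] by (simp add: r_def)
    then show ?thesis by linarith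
  qed simp
  \<comment> \<open>The new box of content \<open>c\<close> is the next one on its diagonal, in row
    \<open>Suc (r c)\<close>; by \<open>nn\<close> its column is at least 1, so \<open>nat\<close>
    loses nothing.\<close>
  define f where "f c = (Suc (r c), nat (int (Suc (r c)) + c))" for c
  have cf: "content (f c) = c" for c using nn[of c] by (simp add: f_def content_def)
  have disj: "diagram \<kappa> \<inter> f ` {x + 1..x + int t} = {}"
  proof -
    have "f c \<notin> diagram \<kappa>" for c
      using nn[of c] by (simp add: f_def diagram_beads[OF assms(1)] r_def add.commute)
    then show ?thesis by blast
  qed
  have "q \<in> diagram \<nu> \<longleftrightarrow> q \<in> diagram \<kappa> \<union> f ` {x + 1..x + int t}" for q
  proof -
    obtain i j where q: "q = (i, j)" by (cases q)
    define c where "c = int j - int i"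
    have "content q = c" by (simp add: q c_def content_def)
    then have "q \<in> f ` {x + 1..x + int t} \<longleftrightarrow> q = f c \<and> c \<in> {x + 1..x + int t}"
      unfolding image_iff using cf by metis
    also have "q = f c \<longleftrightarrow> i = Suc (r c)" by (auto simp: q f_def c_def)
    finally have 1: "q \<in> f ` {x + 1..x + int t} \<longleftrightarrow> i = Suc (r c) \<and> x < c \<and> c \<le> x + int t" by auto
    have "1 \<le> j" if "i = Suc (r c)" using that nn[of c] by (simp add: c_def)
    with 1 show ?thesis
      unfolding Un_iff 1 unfolding q diagram_beads[OF assms(1)] diagram_beads[OF assms(2)] r c_def[symmetric]
      by (auto simp: r_def[symmetric])
  qed
  then have "diagram \<nu> = diagram \<kappa> \<union> f ` {x + 1..x + int t}" by blast
  then have "(\<Sum>q \<in> diagram \<nu>. g (content q)) =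
    (\<Sum>q \<in> diagram \<kappa>. g (content q)) + (\<Sum>q \<in> f ` {x + 1..x + int t}. g (content q))"
    using disj by (simp add: sum.union_disjoint finite_diagram)
  moreover have "inj_on f {x + 1..x + int t}" using cf by (metis inj_onI)
  ultimately show ?thesis by (simp add: sum.reindex cf)
qed

lemma sum_list_add_hook:
  assumes "adds_hook t \<kappa> \<nu>"
  shows "sum_list \<nu> = sum_list \<kappa> + t"
proof -
  obtain x where "is_partition \<kappa>" "is_partition \<nu>" "x \<in> beads \<kappa>" "x + int t \<notin> beads \<kappa>"
    "beads \<nu> = insert (x + int t) (beads \<kappa> - {x})"
    using assms by (auto simp: adds_hook_iff)
  from sum_content_add_hook[OF this, of "\<lambda>_. 1 :: nat"] show ?thesis by (simp add: card_diagram)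
qed

text \<open>Peeling off the largest bead removes the first row, and the other beads move up by one
  because the remaining rows are renumbered. The bound \<open>- int (card S)\<close> expresses the
  balance of the 01-sequence: from position -m on there are exactly m beads.\<close>

lemma partition_of_beads:
  assumes "finite S" "\<And>x. x \<in> S \<Longrightarrow> - int (card S) \<le> x"
  shows "\<exists>\<nu>. is_partition \<nu> \<and> beads \<nu> = S \<union> {..< - int (card S)}"
  using assms
proof (induction "card S" arbitrary: S)
  case 0
  have "beads [] = {..<0}"
  proof (intro set_eqI iffI)
    fix x :: int assume "x \<in> {..<0}"
    then show "x \<in> beads []" by (intro beads_below) simp
  qed (auto simp: beads_def row_def)
  then show ?case using 0 by (intro exI[of _ "[]"]) (auto simp: is_partition_def)
next
  case (Suc m)
  define s where "s = Max S"
  have ne: "S \<noteq> {}" using Suc.hyps(2) by auto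
  then have s: "s \<in> S" "\<And>x. x \<in> S \<Longrightarrow> x \<le> s" using Suc.prems(1) by (auto simp: s_def)
  define T where "T = (\<lambda>x. x + 1) ` (S - {s})"
  have cT: "card T = m" "finite T"
    using Suc.hyps(2) s(1) Suc.prems(1) by (simp_all add: T_def card_image)
  have "- int (card T) \<le> x" if "x \<in> T" for x
    using that Suc.prems(2) Suc.hyps(2) cT by (force simp: T_def)
  from Suc.hyps(1)[OF cT(1)[symmetric] cT(2) this]
  obtain \<nu> where \<nu>: "is_partition \<nu>" "beads \<nu> = T \<union> {..< - int m}" using cT by auto
  have S: "S = insert s ((\<lambda>x. x - 1) ` T)" using s(1) by (simp add: T_def image_image insert_absorb)
  have "S \<subseteq> {- int (Suc m)..s}" using s Suc.prems(2) Suc.hyps(2) by auto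
  from card_mono[OF _ this] have sm: "- 1 \<le> s" using Suc.hyps(2) by auto
  have r1: "int (row \<nu> 1) \<le> s + 1"
  proof -
    have "int (row \<nu> 1) - 1 \<in> beads \<nu>" by (auto simp: beads_def intro!: image_eqI[of _ _ 1])
    moreover have "y < s + 1" if "y \<in> T" for y
      using that s(2)[of "y - 1"] by (auto simp: T_def)
    ultimately have "int (row \<nu> 1) - 1 \<le> s" using \<nu>(2) sm by force
    then show ?thesis by simp
  qed
  \<comment> \<open>A largest bead at -1 means an empty first row, which a list of positive parts
    cannot contain; all later rows are then empty as well, and \<open>[]\<close> has the right rows
    because \<open>row\<close> defaults to 0.\<close>
  define \<kappa> where "\<kappa> = (if s = - 1 then [] else nat (s + 1) # \<nu>)"
  have \<nu>0: "\<nu> = []" if "s = - 1"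
  proof (rule ccontr)
    assume "\<nu> \<noteq> []"
    then have "hd \<nu> = 0" using r1 that by (cases \<nu>) (simp_all add: row_def)
    then show False using \<nu>(1) \<open>\<nu> \<noteq> []\<close> by (auto simp: is_partition_def dest: hd_in_set)
  qed
  have rk: "row \<kappa> (Suc i) = (if i = 0 then nat (s + 1) else row \<nu> i)" for i
    using \<nu>0 by (auto simp: \<kappa>_def row_def nth_Cons split: nat.splits)
  have "is_partition \<kappa>"
  proof (cases "s = - 1")
    case False
    have "y \<le> nat (s + 1)" if y: "y \<in> set \<nu>" for y
    proof -
      obtain l where "l < length \<nu>" "y = \<nu> ! l" using y unfolding in_set_conv_nth by blast
      then have "y = row \<nu> (Suc l)" by (simp add: row_def)
      then show ?thesis using r1 row_antimono[OF \<nu>(1), of 1 "Suc l"] by simp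
    qed
    then show ?thesis using \<nu>(1) sm False by (auto simp: \<kappa>_def is_partition_def)
  qed (simp add: \<kappa>_def is_partition_def)
  moreover have "beads \<kappa> = insert s ((\<lambda>x. x - 1) ` beads \<nu>)"
  proof -
    have "{1..} = insert (Suc 0) (Suc ` {1..})"
    proof (intro set_eqI iffI)
      fix l :: nat assume "l \<in> {1..}"
      then show "l \<in> insert (Suc 0) (Suc ` {1..})"
        by (cases "l = 1") (auto intro!: image_eqI[of _ _ "l - 1"])
    qed auto
    then have "beads \<kappa> = (\<lambda>i. int (row \<kappa> i) - int i) ` insert (Suc 0) (Suc ` {1..})"
      unfolding beads_def by (rule arg_cong)
    also have "\<dots> = insert s ((\<lambda>i. int (row \<nu> i) - int i - 1) ` {1..})"
      unfolding image_insert image_image rk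
      by (intro arg_cong2[where f = insert] image_cong) (use sm in auto)
    finally show ?thesis by (simp add: beads_def image_image)
  qed
  then have "beads \<kappa> = S \<union> {..< - int (card S)}"
  proof -
    assume *: "beads \<kappa> = insert s ((\<lambda>x. x - 1) ` beads \<nu>)"
    have "(\<lambda>x. x - 1) ` {..< - int m} = {..< - int (Suc m)}"
    proof (intro set_eqI iffI)
      fix x :: int assume "x \<in> {..< - int (Suc m)}"
      then show "x \<in> (\<lambda>x. x - 1) ` {..< - int m}" by (intro image_eqI[of _ _ "x + 1"]) auto
    qed auto
    then show ?thesis unfolding * \<nu>(2) image_Un using S Suc.hyps(2) by simp
  qed
  ultimately show ?case by blast
qed

text \<open>Past the last row the bead of row \<open>i\<close> is \<open>- i\<close>, so the beads
  from \<open>L\<close> on are those of the rows 1, ..., \<open>- L\<close>. This is the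
  normalization that \<open>partition_of_beads\<close> asks for.\<close>

lemma card_beads_ge:
  assumes "is_partition \<nu>" "L < - int (length \<nu>)"
  shows "int (card {x \<in> beads \<nu>. L \<le> x}) = - L"
proof -
  have 1: "L \<le> int (row \<nu> i) - int i \<longleftrightarrow> i \<le> nat (- L)" if "1 \<le> i" for i
    using assms(2) that by (cases "i \<le> length \<nu>") (auto simp: row_def)
  then have "i \<le> card {x \<in> beads \<nu>. L \<le> x} \<longleftrightarrow> i \<le> nat (- L)" if "1 \<le> i" for i
    using bead_ge_iff[OF assms(1) that, of L] that by simp
  from this[of "nat (- L)"] this[of "Suc (nat (- L))"] assms(2)
  have "card {x \<in> beads \<nu>. L \<le> x} = nat (- L)" by linarith
  then show ?thesis using assms(2) by simp
qed

lemma move_bead_partition: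
  assumes "is_partition \<kappa>" "x \<in> beads \<kappa>" "x + int t \<notin> beads \<kappa>"
  obtains \<nu> where "is_partition \<nu>" "beads \<nu> = insert (x + int t) (beads \<kappa> - {x})"
proof -
  \<comment> \<open>Below the last row, so that \<open>card_beads_ge\<close> applies, and not above
    \<open>x\<close>, so that the bead is counted before and after the move.\<close>
  define L where "L = min x (- int (length \<kappa>) - 1)"
  define B where "B = {y \<in> beads \<kappa>. L \<le> y}"
  define S where "S = insert (x + int t) (B - {x})"
  have fB: "finite B" unfolding B_def by (rule finite_beads_ge[OF assms(1)])
  have cB: "int (card B) = - L" unfolding B_def by (rule card_beads_ge[OF assms(1)]) (simp add: L_def)
  have "x \<in> B" "x + int t \<notin> B" using assms by (auto simp: B_def L_def)
  then have cS: "card S = card B" unfolding S_def by (rule card_exchange[OF fB])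
  have "- int (card S) \<le> y" if "y \<in> S" for y
    using that cS cB by (auto simp: S_def B_def L_def)
  then obtain \<nu> where \<nu>: "is_partition \<nu>" "beads \<nu> = S \<union> {..< L}"
    using partition_of_beads[of S] fB cB cS by (auto simp: S_def)
  have low: "y \<in> beads \<kappa>" if "y < L" for y using that beads_below by (simp add: L_def)
  have "beads \<nu> = insert (x + int t) (beads \<kappa> - {x})"
    unfolding \<nu>(2) S_def B_def using low by (auto simp: L_def)
  with \<nu>(1) that show thesis by blast
qed

subsection \<open>Hooks as pairs of a bead and a lower gap\<close>

text \<open>A box in row \<open>i\<close> and column \<open>j\<close> corresponds to the pair of the vertical edge of row \<open>i\<close> and
  the horizontal edge of column \<open>j\<close>; its hook length is their distance.\<close>

definition inversions :: "nat \<Rightarrow> int set \<Rightarrow> (int \<times> int) set" where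
  "inversions t Z = {(y, x). y \<in> Z \<and> x \<notin> Z \<and> x < y \<and> int t dvd y - x}"

definition hook_prod :: "nat \<Rightarrow> int set \<Rightarrow> real" where
  "hook_prod t Z = (\<Prod>(y, x) \<in> inversions t Z. real_of_int (y - x))"

definition col :: "nat list \<Rightarrow> nat \<Rightarrow> nat" where
  "col \<nu> j = card {i. (i, j) \<in> diagram \<nu>}"

lemma down_closed_eq_atLeastAtMost:
  fixes S :: "nat set"
  assumes "finite S" "0 \<notin> S" "\<And>i k. i \<in> S \<Longrightarrow> 1 \<le> k \<Longrightarrow> k \<le> i \<Longrightarrow> k \<in> S"
  shows "S = {1..card S}"
proof (cases "S = {}")
  case False
  have "S = {1..Max S}"
  proof (intro equalityI subsetI)
    fix i assume "i \<in> S"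
    then show "i \<in> {1..Max S}" using assms(1,2) by (cases i) auto
  next
    fix i assume "i \<in> {1..Max S}"
    then show "i \<in> S" using assms(3)[OF Max_in[OF assms(1) False]] by simp
  qed
  then show ?thesis by (metis card_atLeastAtMost diff_Suc_1 Suc_eq_plus1)
qed simp

lemma diagram_col:
  assumes "is_partition \<nu>"
  shows "(i, j) \<in> diagram \<nu> \<longleftrightarrow> 1 \<le> i \<and> i \<le> col \<nu> j"
proof -
  have "{i. (i, j) \<in> diagram \<nu>} = {1..card {i. (i, j) \<in> diagram \<nu>}}"
  proof (rule down_closed_eq_atLeastAtMost)
    show "finite {i. (i, j) \<in> diagram \<nu>}"
      by (rule finite_subset[OF _ finite_imageI[OF finite_diagram, of fst]]) force
  next
    fix i k assume "i \<in> {i. (i, j) \<in> diagram \<nu>}" "1 \<le> k" "k \<le> i"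
    then show "k \<in> {i. (i, j) \<in> diagram \<nu>}"
      using row_antimono[OF assms, of k i] by (auto simp: diagram_row)
  qed (simp add: diagram_row)
  then show ?thesis unfolding col_def by (metis atLeastAtMost_iff mem_Collect_eq)
qed

lemma hook_length_eq:
  assumes "is_partition \<nu>" "(i, j) \<in> diagram \<nu>"
  shows "int (hook_length \<nu> (i, j)) = (int (row \<nu> i) - int i) - (int j - 1 - int (col \<nu> j))"
proof -
  have ij: "1 \<le> i" "1 \<le> j" "j \<le> row \<nu> i" "i \<le> col \<nu> j"
    using assms(2) diagram_row[of i j \<nu>] diagram_col[OF assms(1), of i j] by auto
  have "{j'. (i, j') \<in> diagram \<nu> \<and> j < j'} = {j<..row \<nu> i}" using ij by (auto simp: diagram_row)
  moreover have "{i'. (i', j) \<in> diagram \<nu> \<and> i < i'} = {i<..col \<nu> j}"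
    using ij by (auto simp: diagram_col[OF assms(1)])
  ultimately show ?thesis using ij by (simp add: hook_length_def)
qed

text \<open>Equality would mean \<open>row \<nu> i - j = i - 1 - col \<nu> j\<close>, but the left
  side is nonnegative exactly when \<open>(i, j)\<close> is a box and the right side exactly when it
  is not.\<close>

lemma gap_of_col:
  assumes "is_partition \<nu>" "1 \<le> j"
  shows "int j - 1 - int (col \<nu> j) \<notin> beads \<nu>"
proof
  assume "int j - 1 - int (col \<nu> j) \<in> beads \<nu>"
  then obtain i where i: "1 \<le> i" "int j - 1 - int (col \<nu> j) = int (row \<nu> i) - int i"
    by (auto simp: beads_def)
  have "j \<le> row \<nu> i \<longleftrightarrow> i \<le> col \<nu> j"
    using i(1) assms(2) diagram_row[of i j \<nu>] diagram_col[OF assms(1), of i j] by auto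
  then show False using i by linarith
qed

text \<open>The column is forced: its height has to be the number \<open>r\<close> of beads above
  the gap, so \<open>j = x + 1 + r\<close>. If this were 0, the bead of row \<open>Suc r\<close>
  would sit at \<open>x\<close>.\<close>

lemma col_of_gap:
  assumes "is_partition \<nu>" "x \<notin> beads \<nu>"
  obtains j where "1 \<le> j" "x = int j - 1 - int (col \<nu> j)"
proof -
  define r where "r = card {y \<in> beads \<nu>. x \<le> y}"
  have r: "x < int (row \<nu> i) - int i \<longleftrightarrow> i \<le> r" if "1 \<le> i" for i
  proof -
    have "x \<noteq> int (row \<nu> i) - int i" using assms(2) beadI[OF that] by blast
    then show ?thesis using bead_ge_iff[OF assms(1) that, of x] by (auto simp: r_def)
  qed
  have "\<not> x < int (row \<nu> (Suc r)) - int (Suc r)" using r[of "Suc r"] by simp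
  then have up: "int (row \<nu> (Suc r)) \<le> x + 1 + int r" by simp
  define j where "j = nat (x + 1 + int r)"
  have x: "x + 1 + int r \<noteq> 0"
  proof
    assume 0: "x + 1 + int r = 0"
    then have "row \<nu> (Suc r) = 0" using up by simp
    then have "x = int (row \<nu> (Suc r)) - int (Suc r)" using 0 by simp
    then show False using assms(2) beadI[of "Suc r" \<nu>] by simp
  qed
  then have j: "1 \<le> j" "int j = x + 1 + int r" using up by (auto simp: j_def)
  have "j \<le> row \<nu> i \<longleftrightarrow> i \<le> r" if i: "1 \<le> i" for i
  proof (cases "i \<le> r")
    case True
    then have "x < int (row \<nu> r) - int r" using r[of r] i by simp
    then show ?thesis using True row_antimono[OF assms(1) i, of r] j by simp
  next
    case False
    then have "row \<nu> i \<le> row \<nu> (Suc r)" using row_antimono[OF assms(1), of "Suc r" i] by simp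
    then have "int (row \<nu> i) \<le> int j" using up j by simp
    moreover have "row \<nu> i \<noteq> j"
    proof
      assume "row \<nu> i = j"
      then have "row \<nu> (Suc r) = j" using \<open>row \<nu> i \<le> row \<nu> (Suc r)\<close> up j by simp
      then have "x = int (row \<nu> (Suc r)) - int (Suc r)" using j by simp
      then show False using assms(2) beadI[of "Suc r" \<nu>] by simp
    qed
    ultimately show ?thesis using False by simp
  qed
  then have "i \<le> col \<nu> j \<longleftrightarrow> i \<le> r" if "1 \<le> i" for i
    using that j(1) diagram_row[of i j \<nu>] diagram_col[OF assms(1), of i j] by auto
  from this[of r] this[of "col \<nu> j"] have "col \<nu> j = r" by linarith
  then show thesis using that[of j] j by simp
qed

lemma bij_betw_diagram_inversions:
  assumes "is_partition \<nu>"
  shows "bij_betw (\<lambda>(i, j). (int (row \<nu> i) - int i, int j - 1 - int (col \<nu> j)))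
    (diagram \<nu>) {(y, x). y \<in> beads \<nu> \<and> x \<notin> beads \<nu> \<and> x < y}"
  unfolding bij_betw_def
proof
  let ?\<phi> = "\<lambda>(i, j). (int (row \<nu> i) - int i, int j - 1 - int (col \<nu> j))"
  have col_anti: "col \<nu> j' \<le> col \<nu> j" if "1 \<le> j" "j \<le> j'" for j j'
    using that diagram_col[OF assms, of "col \<nu> j'" j'] diagram_col[OF assms, of "col \<nu> j'" j]
      diagram_row[of "col \<nu> j'" j' \<nu>] diagram_row[of "col \<nu> j'" j \<nu>]
    by (cases "col \<nu> j' = 0") auto
  show "inj_on ?\<phi> (diagram \<nu>)"
  proof (rule inj_onI)
    fix p q assume pq: "p \<in> diagram \<nu>" "q \<in> diagram \<nu>" "?\<phi> p = ?\<phi> q"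
    obtain i j i' j' where e: "p = (i, j)" "q = (i', j')" by (cases p, cases q)
    have "i = i'" using pq inj_bead[OF assms] unfolding e
      by (auto simp: diagram_row inj_on_def)
    moreover have "j = j'"
      using pq col_anti[of j j'] col_anti[of j' j] unfolding e
      by (cases j j' rule: linorder_cases) (auto simp: diagram_row)
    ultimately show "p = q" using e by simp
  qed
  show "?\<phi> ` diagram \<nu> = {(y, x). y \<in> beads \<nu> \<and> x \<notin> beads \<nu> \<and> x < y}"
  proof (intro equalityI subsetI)
    fix p assume "p \<in> ?\<phi> ` diagram \<nu>"
    then obtain i j where ij: "(i, j) \<in> diagram \<nu>" "p = ?\<phi> (i, j)" by auto
    have "int j - 1 - int (col \<nu> j) < int (row \<nu> i) - int i"
      using hook_length_eq[OF assms ij(1)] by (simp add: hook_length_def)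
    moreover have "int (row \<nu> i) - int i \<in> beads \<nu>" using ij(1) by (auto simp: beads_def diagram_row)
    moreover have "int j - 1 - int (col \<nu> j) \<notin> beads \<nu>"
      using gap_of_col[OF assms, of j] ij(1) by (auto simp: diagram_row)
    ultimately show "p \<in> {(y, x). y \<in> beads \<nu> \<and> x \<notin> beads \<nu> \<and> x < y}" using ij(2) by simp
  next
    fix p assume "p \<in> {(y, x). y \<in> beads \<nu> \<and> x \<notin> beads \<nu> \<and> x < y}"
    then obtain y x where p: "p = (y, x)" "y \<in> beads \<nu>" "x \<notin> beads \<nu>" "x < y" by auto
    obtain i where i: "1 \<le> i" "y = int (row \<nu> i) - int i" using p(2) by (auto simp: beads_def)
    obtain j where j: "1 \<le> j" "x = int j - 1 - int (col \<nu> j)" using col_of_gap[OF assms p(3)] .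
    have "j \<le> row \<nu> i"
    proof (rule ccontr)
      assume "\<not> j \<le> row \<nu> i"
      then have "col \<nu> j < i" using i(1) j(1) diagram_row[of i j \<nu>] diagram_col[OF assms, of i j] by auto
      then show False using \<open>\<not> j \<le> row \<nu> i\<close> p(4) i j by linarith
    qed
    then show "p \<in> ?\<phi> ` diagram \<nu>"
      using i j p by (intro image_eqI[of _ _ "(i, j)"]) (auto simp: diagram_row)
  qed
qed

lemma G_eq_hook_prod:
  assumes "is_partition \<nu>"
  shows "G t \<nu> = 1 / hook_prod t (beads \<nu>)"
proof -
  let ?\<phi> = "\<lambda>(i, j). (int (row \<nu> i) - int i, int j - 1 - int (col \<nu> j))"
  let ?D = "{q \<in> diagram \<nu>. t dvd hook_length \<nu> q}"
  have len: "int (hook_length \<nu> q) = fst (?\<phi> q) - snd (?\<phi> q)" if "q \<in> diagram \<nu>" for q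
    using hook_length_eq[OF assms, of "fst q" "snd q"] that by (simp add: case_prod_beta)
  have dvd: "t dvd hook_length \<nu> q \<longleftrightarrow> int t dvd fst (?\<phi> q) - snd (?\<phi> q)" if "q \<in> diagram \<nu>" for q
    using len[OF that] by (metis int_dvd_int_iff)
  have "bij_betw ?\<phi> ?D (inversions t (beads \<nu>))"
  proof -
    have "?\<phi> ` ?D = inversions t (beads \<nu>)"
    proof -
      have "?\<phi> ` ?D = {p \<in> ?\<phi> ` diagram \<nu>. int t dvd fst p - snd p}" using dvd by auto
      then show ?thesis
        unfolding bij_betw_imp_surj_on[OF bij_betw_diagram_inversions[OF assms]]
        by (auto simp: inversions_def)
    qed
    then show ?thesis
      using bij_betw_subset[OF bij_betw_diagram_inversions[OF assms], of ?D] by auto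
  qed
  then have "hook_prod t (beads \<nu>) = (\<Prod>q\<in>?D. real_of_int (fst (?\<phi> q) - snd (?\<phi> q)))"
    unfolding hook_prod_def case_prod_beta by (rule prod.reindex_bij_betw[symmetric])
  also have "\<dots> = (\<Prod>q\<in>?D. real (hook_length \<nu> q))"
    by (intro prod.cong refl) (simp flip: len)
  also have "\<dots> = real (\<Prod>q\<in>?D. hook_length \<nu> q)" by simp
  also have "\<dots> = real (\<Prod>h \<in># filter_mset (\<lambda>h. t dvd h) (hook_lengths \<nu>). h)"
    by (simp only: hook_lengths_def filter_mset_image_mset image_mset.compositionality
        filter_mset_mset_set[OF finite_diagram] prod_unfold_prod_mset comp_def)
  finally show ?thesis by (simp add: G_def)
qed

text \<open>A bead with a gap \<open>t\<close> below it is a box of hook length \<open>t\<close>.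
  Iterated, this says that each residue class of a core is filled without gaps up to its highest
  bead.\<close>

lemma is_t_core_beads:
  assumes "is_t_core t \<mu>" "t > 0" "y \<in> beads \<mu>"
  shows "y - int t \<in> beads \<mu>"
proof (rule ccontr)
  assume *: "y - int t \<notin> beads \<mu>"
  have p: "is_partition \<mu>" using assms(1) by (simp add: is_t_core_def)
  have "(y, y - int t) \<in> {(y, x). y \<in> beads \<mu> \<and> x \<notin> beads \<mu> \<and> x < y}"
    using * assms(2,3) by simp
  then obtain i j where ij: "(i, j) \<in> diagram \<mu>"
    "y = int (row \<mu> i) - int i" "y - int t = int j - 1 - int (col \<mu> j)"
    unfolding bij_betw_imp_surj_on[OF bij_betw_diagram_inversions[OF p], symmetric]
    by (elim imageE) (simp split: prod.splits)
  then have "hook_length \<mu> (i, j) = t" using hook_length_eq[OF p ij(1)] by linarith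
  moreover have "hook_length \<mu> (i, j) \<in># hook_lengths \<mu>"
    using ij(1) by (simp add: hook_lengths_def finite_diagram)
  ultimately show False using assms(1) unfolding is_t_core_def by (metis dvd_refl)
qed

subsection \<open>Moments of partial fraction coefficients\<close>

text \<open>The expansion at an arbitrary \<open>x\<close> is what makes the induction work: the weight of a newly
  added node is a multiple of the old expansion evaluated there.\<close>

lemma partial_fraction_weights:
  fixes f h :: "'i \<Rightarrow> 'a :: field_char_0"
  assumes "finite C" "z \<notin> C" "inj_on f (insert z C)"
  defines "P \<equiv> \<lambda>i. (\<Prod>j\<in>C. f i - h j) / (\<Prod>j\<in>insert z C - {i}. f i - f j)"
  shows "\<And>x. x \<notin> f ` insert z C \<Longrightarrow>
      (\<Sum>i\<in>insert z C. P i / (x - f i)) = (\<Prod>j\<in>C. x - h j) / (\<Prod>j\<in>insert z C. x - f j)"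
    and "(\<Sum>i\<in>insert z C. P i) = 1"
    and "(\<Sum>i\<in>insert z C. P i * f i) = f z + (\<Sum>j\<in>C. f j - h j)"
    and "2 * (\<Sum>i\<in>insert z C. P i * (f i)\<^sup>2) =
      (f z + (\<Sum>j\<in>C. f j - h j))\<^sup>2 + (f z)\<^sup>2 + (\<Sum>j\<in>C. (f j)\<^sup>2 - (h j)\<^sup>2)"
proof -
  define R where "R C i = (\<Prod>j\<in>C. f i - h j) / (\<Prod>j\<in>insert z C - {i}. f i - f j)" for C i
  have "(\<forall>x. x \<notin> f ` insert z C \<longrightarrow>
      (\<Sum>i\<in>insert z C. R C i / (x - f i)) = (\<Prod>j\<in>C. x - h j) / (\<Prod>j\<in>insert z C. x - f j))
    \<and> (\<Sum>i\<in>insert z C. R C i) = 1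
    \<and> (\<Sum>i\<in>insert z C. R C i * f i) = f z + (\<Sum>j\<in>C. f j - h j)
    \<and> 2 * (\<Sum>i\<in>insert z C. R C i * (f i)\<^sup>2) =
      (f z + (\<Sum>j\<in>C. f j - h j))\<^sup>2 + (f z)\<^sup>2 + (\<Sum>j\<in>C. (f j)\<^sup>2 - (h j)\<^sup>2)"
    using assms(1-3)
  proof (induction C)
    case empty
    then show ?case by (simp add: R_def power2_eq_square)
  next
    case (insert l C)
    define B where "B = insert z C"
    have l: "l \<notin> B" and fin: "finite B" "finite C" and oB: "insert z (insert l C) = insert l B"
      using insert.hyps insert.prems by (auto simp: B_def)
    have fl: "f l \<notin> f ` B" using insert.prems(2) l unfolding oB by auto
    then have fl': "f l - f i \<noteq> 0" "f i - f l \<noteq> 0" if "i \<in> B" for i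
    using that by (metis imageI right_minus_eq)+
    have "inj_on f B" "z \<notin> C" using insert.prems by (auto simp: B_def)
    note IH = insert.IH[folded B_def, OF \<open>z \<notin> C\<close> \<open>inj_on f B\<close>]
    define d where "d = f l - h l"
    have IH1: "(\<Sum>i\<in>B. R C i / (x - f i)) = (\<Prod>j\<in>C. x - h j) / (\<Prod>j\<in>B. x - f j)"
      if "x \<notin> f ` B" for x using IH that by blast
    have old: "R (insert l C) i = R C i * (f i - h l) / (f i - f l)" if "i \<in> B" for i
    proof -
      have "insert z (insert l C) - {i} = insert l (B - {i})" using that l oB by auto
      then show ?thesis using that l fin insert.hyps(2)
        by (simp add: R_def B_def[symmetric] mult.commute)
    qed
    have "insert z (insert l C) - {l} = B" using l oB by auto
    then have new: "R (insert l C) l = d * (\<Sum>i\<in>B. R C i / (f l - f i))"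
      using IH1[OF fl] insert.hyps by (simp add: R_def d_def)
    \<comment> \<open>Since \<open>(f i - h l) / (f i - f l) = 1 - d / (f l - f i)\<close>, the new
      node takes over weight from the old ones, and the sum of \<open>g\<close> changes by
      \<open>d\<close> times the weighted sum of its divided differences. The cases 1,
      \<open>x\<close>, \<open>x\<^sup>2\<close> and a simple pole yield the four claims.\<close>
    have step: "(\<Sum>i\<in>insert l B. R (insert l C) i * g (f i)) =
      (\<Sum>i\<in>B. R C i * g (f i)) + d * (\<Sum>i\<in>B. R C i * ((g (f l) - g (f i)) / (f l - f i)))" for g
    proof -
      have "R (insert l C) i * g (f i) + d * (R C i / (f l - f i)) * g (f l) =
        R C i * g (f i) + d * (R C i * ((g (f l) - g (f i)) / (f l - f i)))" if "i \<in> B" for i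
        unfolding old[OF that] d_def using fl'[OF that] by (simp add: divide_simps) (simp add: algebra_simps)
      from sum.cong[OF refl this, of B "\<lambda>i. i"]
      show ?thesis using l fin
        by (simp add: new sum.distrib sum_distrib_left sum_distrib_right add.commute)
    qed
    have 0: "(\<Sum>i\<in>insert l B. R (insert l C) i) = 1"
      using step[of "\<lambda>_. 1"] IH by simp
    have "(g (f l) - g (f i)) / (f l - f i) = 1" if "i \<in> B" "g = (\<lambda>x. x)" for i g
      using fl'[OF that(1)] that(2) by simp
    then have "(\<Sum>i\<in>B. R C i * ((f l - f i) / (f l - f i))) = (\<Sum>i\<in>B. R C i)"
      by (intro sum.cong) auto
    then have 1: "(\<Sum>i\<in>insert l B. R (insert l C) i * f i) = (\<Sum>i\<in>B. R C i * f i) + d"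
      using step[of "\<lambda>x. x"] IH by simp
    have "((f l)\<^sup>2 - (f i)\<^sup>2) / (f l - f i) = f l + f i" if "i \<in> B" for i
      using fl'[OF that] by (simp add: power2_eq_square square_diff_square_factored)
    then have "(\<Sum>i\<in>B. R C i * (((f l)\<^sup>2 - (f i)\<^sup>2) / (f l - f i))) = (\<Sum>i\<in>B. R C i * (f l + f i))"
      by (intro sum.cong) auto
    also have "\<dots> = f l + (\<Sum>i\<in>B. R C i * f i)"
      using IH by (simp add: distrib_left sum.distrib flip: sum_distrib_right)
    finally have 2: "(\<Sum>i\<in>insert l B. R (insert l C) i * (f i)\<^sup>2) =
        (\<Sum>i\<in>B. R C i * (f i)\<^sup>2) + d * (f l + (\<Sum>i\<in>B. R C i * f i))"
      using step[of "\<lambda>x. x\<^sup>2"] by simp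
    have pf: "(\<Sum>i\<in>insert l B. R (insert l C) i / (x - f i)) =
      (\<Prod>j\<in>insert l C. x - h j) / (\<Prod>j\<in>insert l B. x - f j)" if "x \<notin> f ` insert l B" for x
    proof -
      have x: "x - f i \<noteq> 0" if "i \<in> insert l B" for i using that \<open>x \<notin> _\<close> by auto
      have "R C i * (1 / (x - f i)) + d * (R C i * ((1 / (x - f l) - 1 / (x - f i)) / (f l - f i)))
        = (x - h l) / (x - f l) * (R C i / (x - f i))" if "i \<in> B" for i
        using x[of i] x[of l] fl'[OF that] that unfolding d_def by (simp add: divide_simps) (simp add: algebra_simps)
      from sum.cong[OF refl this, of B "\<lambda>i. i"]
      have "(\<Sum>i\<in>insert l B. R (insert l C) i * (1 / (x - f i))) =
        (x - h l) / (x - f l) * (\<Sum>i\<in>B. R C i / (x - f i))"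
        unfolding step[of "\<lambda>y. 1 / (x - y)"] by (simp add: sum.distrib sum_distrib_left)
      then show ?thesis using IH1[of x] that l fin insert.hyps by simp
    qed
    \<comment> \<open>With p_k the k-th power sum of the poles minus that of the zeros, this is the
      identity 2 h_2 = p_1^2 + p_2 for the complete symmetric function h_2.\<close>
    have "2 * (\<Sum>i\<in>insert l B. R (insert l C) i * (f i)\<^sup>2) =
      (f z + (\<Sum>j\<in>insert l C. f j - h j))\<^sup>2 + (f z)\<^sup>2 + (\<Sum>j\<in>insert l C. (f j)\<^sup>2 - (h j)\<^sup>2)"
      unfolding 2 distrib_left using IH insert.hyps
      by (simp add: d_def power2_eq_square algebra_simps)
    with 0 1 pf IH show ?case unfolding oB using insert.hyps by (simp add: d_def add.assoc add.commute)
  qed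
  moreover have "P = R C" by (simp add: P_def R_def fun_eq_iff)
  ultimately show "\<And>x. x \<notin> f ` insert z C \<Longrightarrow>
      (\<Sum>i\<in>insert z C. P i / (x - f i)) = (\<Prod>j\<in>C. x - h j) / (\<Prod>j\<in>insert z C. x - f j)"
    and "(\<Sum>i\<in>insert z C. P i) = 1"
    and "(\<Sum>i\<in>insert z C. P i * f i) = f z + (\<Sum>j\<in>C. f j - h j)"
    and "2 * (\<Sum>i\<in>insert z C. P i * (f i)\<^sup>2) =
      (f z + (\<Sum>j\<in>C. f j - h j))\<^sup>2 + (f z)\<^sup>2 + (\<Sum>j\<in>C. (f j)\<^sup>2 - (h j)\<^sup>2)"
    by blast+
qed

subsection \<open>The effect of moving a bead on the hook product\<close>

text \<open>The default value 1 lets products run over full ranges of positions without side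
  conditions, and since the weight is never 0 they can be cancelled.\<close>

definition dist_wt :: "nat \<Rightarrow> int \<Rightarrow> int \<Rightarrow> real" where
  "dist_wt t x y = (if x < y \<and> int t dvd y - x then real_of_int (y - x) else 1)"

text \<open>Below every bead, gaps and beads together fill an interval, so multiplying by the distances
  between beads turns the hook product into a product of factorials.\<close>

lemma hook_prod_formula:
  assumes "finite B" "\<And>y. y \<in> B \<Longrightarrow> L \<le> y" "Z = B \<union> {..<L}"
  shows "hook_prod t Z * (\<Prod>y\<in>B. \<Prod>x\<in>B. dist_wt t x y) = (\<Prod>y\<in>B. \<Prod>x\<in>{L..<y}. dist_wt t x y)"
proof -
  let ?S = "Sigma B (\<lambda>y. {L..<y} - B)"
  have fin: "finite ?S" using assms(1) by (intro finite_SigmaI) auto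
  have "hook_prod t Z = (\<Prod>(y, x) \<in> inversions t Z. dist_wt t x y)"
    unfolding hook_prod_def by (rule prod.cong) (auto simp: inversions_def dist_wt_def)
  also have "\<dots> = (\<Prod>(y, x) \<in> ?S. dist_wt t x y)"
  proof (rule prod.mono_neutral_left[OF fin])
    show "inversions t Z \<subseteq> ?S"
    proof
      fix p assume "p \<in> inversions t Z"
      then obtain y x where p: "p = (y, x)" "y \<in> Z" "x \<notin> Z" "x < y" by (auto simp: inversions_def)
      have "x \<notin> B" "L \<le> x" using p(3) assms(3) by auto
      moreover have "y \<in> B" using p(2,4) \<open>L \<le> x\<close> assms(3) by auto
      ultimately show "p \<in> ?S" using p by simp
    qed
    show "\<forall>p\<in>?S - inversions t Z. (case p of (y, x) \<Rightarrow> dist_wt t x y) = 1"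
    proof
      fix p assume p: "p \<in> ?S - inversions t Z"
      obtain y x where e: "p = (y, x)" by (cases p)
      have "y \<in> Z" "x \<notin> Z" "x < y" using p e assms(3) by auto
      then have "\<not> int t dvd y - x" using p e unfolding inversions_def by blast
      then show "(case p of (y, x) \<Rightarrow> dist_wt t x y) = 1" using e by (simp add: dist_wt_def)
    qed
  qed
  also have "\<dots> = (\<Prod>y\<in>B. \<Prod>x\<in>{L..<y} - B. dist_wt t x y)"
    by (rule prod.Sigma[symmetric]) (use assms(1) in auto)
  finally have *: "hook_prod t Z = (\<Prod>y\<in>B. \<Prod>x\<in>{L..<y} - B. dist_wt t x y)" .
  have "(\<Prod>x\<in>{L..<y} - B. dist_wt t x y) * (\<Prod>x\<in>B. dist_wt t x y) = (\<Prod>x\<in>{L..<y}. dist_wt t x y)" for y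
  proof -
    have "(\<Prod>x\<in>B. dist_wt t x y) = (\<Prod>x\<in>{L..<y} \<inter> B. dist_wt t x y)"
    proof (rule prod.mono_neutral_right[OF assms(1)])
      show "\<forall>x\<in>B - {L..<y} \<inter> B. dist_wt t x y = 1"
      proof
        fix x assume "x \<in> B - {L..<y} \<inter> B"
        then have "\<not> x < y" using assms(2)[of x] by auto
        then show "dist_wt t x y = 1" by (simp add: dist_wt_def)
      qed
    qed simp
    then show ?thesis
      using prod.Int_Diff[of "{L..<y}" "\<lambda>x. dist_wt t x y" B] by (simp add: mult.commute)
  qed
  then show ?thesis unfolding * prod.distrib[symmetric] by simp
qed

lemma hook_prod_nonzero: 
  assumes "finite B" "\<And>y. y \<in> B \<Longrightarrow> L \<le> y" "Z = B \<union> {..<L}"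
  shows "hook_prod t Z \<noteq> 0"
proof -
  have "(\<Prod>y\<in>B. \<Prod>x\<in>{L..<y}. dist_wt t x y) \<noteq> 0"
    using assms(1) by (auto simp: prod_zero_iff dist_wt_def)
  with hook_prod_formula[OF assms, of t] show ?thesis by (metis mult_zero_left)
qed

text \<open>\<open>z\<close> is the lowest position of the class of \<open>x\<close> that survives
  the cutoff.\<close>

lemma residue_start:
  fixes L x :: int
  assumes "t > 0" "L \<le> x"
  defines "z \<equiv> L + (x - L) mod int t"
  shows "L \<le> z" "z < L + int t" "int t dvd x - z" "z \<le> x"
    "\<And>y. L \<le> y \<Longrightarrow> y < L + int t \<Longrightarrow> int t dvd x - y \<longleftrightarrow> y = z"
proof -
  show z: "L \<le> z" "z < L + int t" using assms(1) by (simp_all add: z_def)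
  have "x - z = (x - L) - (x - L) mod int t" by (simp add: z_def)
  then show d: "int t dvd x - z" by (metis dvd_minus_mod)
  have "(x - L) mod int t \<le> x - L" using assms by (intro zmod_le_nonneg_dividend) simp
  then show "z \<le> x" by (simp add: z_def)
  show "int t dvd x - y \<longleftrightarrow> y = z" if y: "L \<le> y" "y < L + int t" for y
  proof
    assume "int t dvd x - y"
    from dvd_diff[OF d this] have "int t dvd y - z" by simp
    moreover have "\<bar>y - z\<bar> < \<bar>int t\<bar>" using y z by linarith
    ultimately show "y = z" using dvd_imp_le_int[of "y - z" "int t"] by linarith
  qed (use d in simp)
qed

text \<open>Translation by \<open>t\<close> preserves weights and matches everything except the
  lowest \<open>t\<close> positions, of which a single one lies in the class of \<open>x\<close>.
  Its factor is the reason why the lowest bead is missing from the numerator of the weights.\<close>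

lemma factorial_shift:
  assumes "t > 0" "L \<le> x"
  shows "(\<Prod>y\<in>{L..<x + int t}. dist_wt t y (x + int t)) =
    (\<Prod>y\<in>{L..<x}. dist_wt t y x) * real_of_int (x + int t - (L + (x - L) mod int t))"
proof -
  define z where "z = L + (x - L) mod int t"
  note z = residue_start[OF assms, folded z_def]
  have split: "{L..<x + int t} = {L..<L + int t} \<union> {L + int t..<x + int t}" using assms by auto
  have "(\<Prod>y\<in>{L..<x + int t}. dist_wt t y (x + int t)) =
    (\<Prod>y\<in>{L..<L + int t}. dist_wt t y (x + int t)) *
    (\<Prod>y\<in>{L + int t..<x + int t}. dist_wt t y (x + int t))"
    unfolding split by (rule prod.union_disjoint) auto
  moreover have "(\<Prod>y\<in>{L + int t..<x + int t}. dist_wt t y (x + int t)) = (\<Prod>y\<in>{L..<x}. dist_wt t y x)"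
  proof -
    have "{L + int t..<x + int t} = (\<lambda>y. y + int t) ` {L..<x}" by simp
    moreover have "dist_wt t (y + int t) (x + int t) = dist_wt t y x" for y
      unfolding dist_wt_def add_diff_cancel_right add_less_cancel_right ..
    moreover have "inj_on (\<lambda>y. y + int t) {L..<x}" by (simp add: inj_on_def)
    ultimately show ?thesis by (simp only: prod.reindex comp_def)
  qed
  moreover have "(\<Prod>y\<in>{L..<L + int t}. dist_wt t y (x + int t)) = real_of_int (x + int t - z)"
  proof -
    have "dist_wt t y (x + int t) = (if y = z then real_of_int (x + int t - z) else 1)"
      if "y \<in> {L..<L + int t}" for y
    proof -
      have "int t dvd x + int t - y \<longleftrightarrow> int t dvd x - y"
        using dvd_add_triv_right_iff[of "int t" "x - y"] by (simp add: algebra_simps)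
      then show ?thesis using z(5)[of y] that z(4) assms by (auto simp: dist_wt_def)
    qed
    then have "(\<Prod>y\<in>{L..<L + int t}. dist_wt t y (x + int t)) =
      (\<Prod>y\<in>{L..<L + int t}. if y = z then real_of_int (x + int t - z) else 1)"
      by (intro prod.cong refl)
    then show ?thesis using z by (simp add: prod.delta)
  qed
  ultimately show ?thesis by (simp add: z_def mult.commute)
qed

lemma pair_prod_insert:
  fixes w :: "'i \<Rightarrow> 'i \<Rightarrow> 'a :: comm_monoid_mult"
  assumes "finite B" "u \<notin> B" "w u u = 1"
  shows "(\<Prod>y\<in>insert u B. \<Prod>x\<in>insert u B. w x y) =
    (\<Prod>y\<in>B. \<Prod>x\<in>B. w x y) * (\<Prod>y\<in>B. w u y * w y u)"
  using assms by (simp add: prod.distrib mult_ac)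

text \<open>In the product formulas for both hook products, all pairs not involving the moving bead
  cancel. What remains compares the distances from \<open>x\<close> and from
  \<open>x + int t\<close> to the other beads of the class, up to the factor supplied by
  \<open>factorial_shift\<close>.\<close>

lemma hook_prod_move_bead:
  assumes t: "t > 0" and sub: "{..<L + int t} \<subseteq> Z" and fin: "finite {y \<in> Z. L \<le> y}"
    and x: "x \<in> Z" "L \<le> x" "x + int t \<notin> Z"
  defines "z \<equiv> L + (x - L) mod int t"
  defines "C \<equiv> {y \<in> Z. L \<le> y \<and> int t dvd y - x} - {z}"
  shows "hook_prod t Z / hook_prod t (insert (x + int t) (Z - {x})) =
    (\<Prod>y\<in>C. real_of_int x - real_of_int (y - int t)) /
    (\<Prod>y\<in>insert z C - {x}. real_of_int x - real_of_int y) / real t"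
proof -
  have low: "y \<in> Z" if "y < L + int t" for y using sub that by auto
  note z = residue_start[OF t x(2), folded z_def]
  have zZ: "z \<in> Z" "int t dvd z - x"
    using low[OF z(2)] z(3) by (simp_all add: dvd_diff_commute)
  define B where "B = {y \<in> Z. L \<le> y} - {x}"
  have B: "finite B" "x \<notin> B" "x + int t \<notin> B" using fin x by (auto simp: B_def)
  define V where "V = (\<Prod>y\<in>B. \<Prod>w\<in>B. dist_wt t w y)"
  define Q where "Q = (\<Prod>y\<in>B. \<Prod>w\<in>{L..<y}. dist_wt t w y)"
  define q where "q u = (\<Prod>w\<in>{L..<u}. dist_wt t w u)" for u
  \<comment> \<open>For \<open>u \<noteq> y\<close> at most one of \<open>dist_wt t u y\<close> and
    \<open>dist_wt t y u\<close> differs from 1, so \<open>d\<close> is their product, symmetric in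
    the two positions.\<close>
  define d where "d u y = (if int t dvd y - u then \<bar>real_of_int (u - y)\<bar> else 1)" for u y
  have V0: "V \<noteq> 0" and Q0: "Q \<noteq> 0" and q0: "q u \<noteq> 0" for u
    using B(1) by (auto simp: V_def Q_def q_def prod_zero_iff dist_wt_def)
  have d0: "d u y \<noteq> 0" if "u \<noteq> y" for u y using that by (simp add: d_def)
  have hp: "hook_prod t Z' * (V * (\<Prod>y\<in>B. d u y)) = Q * q u"
    if "u \<notin> B" "L \<le> u" "Z' = insert u B \<union> {..<L}" for u Z'
  proof -
    have "dist_wt t u y * dist_wt t y u = d u y" if "y \<in> B" for y
    proof -
      have "y \<noteq> u" "int t dvd u - y \<longleftrightarrow> int t dvd y - u"
        using that \<open>u \<notin> B\<close> by (auto simp: dvd_diff_commute)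
      then show ?thesis by (auto simp: dist_wt_def d_def)
    qed
    then have "(\<Prod>y\<in>insert u B. \<Prod>w\<in>insert u B. dist_wt t w y) = V * (\<Prod>y\<in>B. d u y)"
      using pair_prod_insert[OF B(1) that(1), of "dist_wt t"] by (simp add: V_def dist_wt_def)
    moreover have "(\<Prod>y\<in>insert u B. \<Prod>w\<in>{L..<y}. dist_wt t w y) = Q * q u"
      using B(1) that(1) by (simp add: Q_def q_def mult.commute)
    moreover have "hook_prod t Z' * (\<Prod>y\<in>insert u B. \<Prod>w\<in>insert u B. dist_wt t w y) =
        (\<Prod>y\<in>insert u B. \<Prod>w\<in>{L..<y}. dist_wt t w y)"
    proof (rule hook_prod_formula[OF _ _ that(3)])
      show "L \<le> y" if "y \<in> insert u B" for y
        using that \<open>L \<le> u\<close> unfolding B_def by blast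
    qed (use B(1) in simp)
    ultimately show ?thesis by (simp only:)
  qed
  have Z: "Z = insert x B \<union> {..<L}" "insert (x + int t) (Z - {x}) = insert (x + int t) B \<union> {..<L}"
  proof -
    have low': "y \<in> Z" if "y < L" for y using that by (intro low) simp
    show Z: "Z = insert x B \<union> {..<L}"
      using x(1) low' by (auto simp: B_def not_less)
    show "insert (x + int t) (Z - {x}) = insert (x + int t) B \<union> {..<L}"
      using Z x(2) B(2) by (subst Z) auto
  qed
  have 1: "hook_prod t Z * (V * (\<Prod>y\<in>B. d x y)) = Q * q x"
    using hp[OF B(2) x(2) Z(1)] .
  have 2: "hook_prod t (insert (x + int t) (Z - {x})) * (V * (\<Prod>y\<in>B. d (x + int t) y)) = Q * q (x + int t)"
    using hp[OF B(3) _ Z(2)] x(2) by simp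
  have 3: "q (x + int t) = q x * real_of_int (x + int t - z)"
    unfolding q_def z_def by (rule factorial_shift[OF t x(2)])
  have D0: "(\<Prod>y\<in>B. d x y) \<noteq> 0" "(\<Prod>y\<in>B. d (x + int t) y) \<noteq> 0"
    unfolding prod_zero_iff[OF B(1)] using B(2,3) d0 by metis+
  have xz: "real_of_int (x + int t - z) \<noteq> 0" using z(4) t by linarith
  have ratio: "a / a' = d2 / d1 / r"
    if "a * (v * d1) = p * s" "a' * (v * d2) = p * (s * r)" "v \<noteq> 0" "d1 \<noteq> 0" "d2 \<noteq> 0" "p \<noteq> 0" "s \<noteq> 0" "r \<noteq> 0"
    for a a' d1 d2 r v p s :: real
  proof -
    have "a = p * s / (v * d1)" "a' = p * (s * r) / (v * d2)"
      using that by (simp_all add: nonzero_eq_divide_eq)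
    then show ?thesis using that(3-) by simp
  qed
  have "hook_prod t Z / hook_prod t (insert (x + int t) (Z - {x})) =
      (\<Prod>y\<in>B. d (x + int t) y) / (\<Prod>y\<in>B. d x y) / real_of_int (x + int t - z)"
    by (rule ratio[OF 1 2[unfolded 3] V0 D0 Q0 q0 xz])
  also have "(\<Prod>y\<in>B. d (x + int t) y) / (\<Prod>y\<in>B. d x y) = (\<Prod>y\<in>B. d (x + int t) y / d x y)"
    by (rule prod_dividef[symmetric])
  also have "\<dots> = (\<Prod>y\<in>{y\<in>B. int t dvd y - x}. d (x + int t) y / d x y)"
  proof (rule prod.mono_neutral_right)
    show "\<forall>y\<in>B - {y \<in> B. int t dvd y - x}. d (x + int t) y / d x y = 1"
    proof
      fix y assume "y \<in> B - {y \<in> B. int t dvd y - x}"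
      then have "\<not> int t dvd y - x" by auto
      moreover have "int t dvd y - (x + int t) \<longleftrightarrow> int t dvd y - x"
        using dvd_add_triv_right_iff[of "int t" "y - (x + int t)"] by (simp add: algebra_simps)
      ultimately show "d (x + int t) y / d x y = 1" by (simp add: d_def)
    qed
  qed (use B in auto)
  also have "{y\<in>B. int t dvd y - x} = insert z C - {x}"
    using zZ z(1) by (auto simp: B_def C_def)
  also have "(\<Prod>y\<in>insert z C - {x}. d (x + int t) y / d x y) =
    (\<Prod>y\<in>insert z C - {x}. (real_of_int x - real_of_int (y - int t)) / (real_of_int x - real_of_int y))"
  proof (rule prod.cong[OF refl])
    fix y assume y: "y \<in> insert z C - {x}"
    then have "int t dvd y - x" "y \<in> Z" "y \<noteq> x"
      using zZ by (auto simp: C_def)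
    then obtain s where "y - x = int t * s" by (elim dvdE)
    then have s: "y = x + int t * s" by simp
    have "s \<noteq> 0" "s \<noteq> 1" using s \<open>y \<noteq> x\<close> \<open>y \<in> Z\<close> x(3) by auto
    have "int t dvd y - (x + int t)" using s by (auto simp: algebra_simps)
    then have "d (x + int t) y / d x y = \<bar>real t * (1 - s)\<bar> / \<bar>real t * s\<bar>"
      using \<open>int t dvd y - x\<close> by (simp add: d_def s algebra_simps)
    \<comment> \<open>No position of the class lies strictly between \<open>x\<close> and
      \<open>x + int t\<close>: the integers \<open>s\<close> and \<open>1 - s\<close> have opposite
      signs, so the absolute values turn into a single sign.\<close>
    also have "\<dots> = (real t * (1 - s)) / (- real t * s)"
      using \<open>s \<noteq> 0\<close> \<open>s \<noteq> 1\<close> t by (cases "s > 0") (auto simp: abs_mult divide_simps)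
    also have "real t * (1 - s) = real_of_int x - real_of_int (y - int t)"
      by (simp add: s algebra_simps)
    also have "- real t * s = real_of_int x - real_of_int y" by (simp add: s)
    finally show "d (x + int t) y / d x y =
      (real_of_int x - real_of_int (y - int t)) / (real_of_int x - real_of_int y)" .
  qed
  also have "\<dots> = (\<Prod>y\<in>insert z C - {x}. real_of_int x - real_of_int (y - int t)) /
     (\<Prod>y\<in>insert z C - {x}. real_of_int x - real_of_int y)"
    by (rule prod_dividef)
  also have "\<dots> / real_of_int (x + int t - z) =
    (\<Prod>y\<in>C. real_of_int x - real_of_int (y - int t)) /
    (\<Prod>y\<in>insert z C - {x}. real_of_int x - real_of_int y) / real t"
  proof -
    have fC: "finite C" using fin by (rule finite_subset[rotated]) (auto simp: C_def)
    \<comment> \<open>The factor of \<open>z\<close> is \<open>x + t - z\<close> and that of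
      \<open>x\<close> would be \<open>t\<close>. Trading one for the other makes the numerator
      independent of which bead moves and leaves the factor 1/t.\<close>
    have "(\<Prod>y\<in>insert z C - {x}. real_of_int x - real_of_int (y - int t)) * real t =
      (\<Prod>y\<in>C. real_of_int x - real_of_int (y - int t)) * real_of_int (x + int t - z)"
    proof (cases "x = z")
      case True
      then have "insert z C - {x} = C" by (auto simp: C_def)
      then show ?thesis using True by simp
    next
      case False
      then have "C = insert x (C - {x})" "insert z C - {x} = insert z (C - {x})" "z \<notin> C - {x}"
        using x by (auto simp: C_def)
      then have "(\<Prod>y\<in>insert z C - {x}. g y) = g z * (\<Prod>y\<in>C - {x}. g y)"
        "(\<Prod>y\<in>C. g y) = g x * (\<Prod>y\<in>C - {x}. g y)" for g :: "int \<Rightarrow> real"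
        using fC prod.remove[OF fC, of x g] by auto
      then show ?thesis by simp
    qed
    then show ?thesis using t xz by (simp add: divide_simps mult.commute)
  qed
  finally show ?thesis .
qed

subsection \<open>Residue classes of beads\<close>

text \<open>The partial fraction weight of a bead vanishes if the position \<open>t\<close> above it is occupied, so
  the sums over the movable beads extend to all beads of the residue class.\<close>

lemma class_transition:
  fixes Z :: "int set" and v :: real
  assumes t: "t > 0" and sub: "{..<L + int t} \<subseteq> Z" and fin: "finite {y \<in> Z. L \<le> y}"
    and z: "L \<le> z" "z < L + int t"
  defines "B \<equiv> {y \<in> Z. L \<le> y \<and> int t dvd y - z}"
  defines "W \<equiv> \<lambda>x. hook_prod t Z / hook_prod t (insert (x + int t) (Z - {x}))"
  shows "(\<Sum>x\<in>{x \<in> B. x + int t \<notin> Z}. W x) = 1 / real t"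
    and "(\<Sum>x\<in>{x \<in> B. x + int t \<notin> Z}. W x * (real_of_int (x + int t) - v)\<^sup>2) =
      ((real_of_int z + real t * real (card B) - v)\<^sup>2 +
        real t * (real_of_int (\<Sum>B) -
          (real (card B) * real_of_int z + real t * real (card B) * (real (card B) - 1) / 2))) / real t"
proof -
  have low: "y \<in> Z" if "y < L + int t" for y using sub that by auto
  define C where "C = B - {z}"
  define h where "h y = real_of_int (y - int t)" for y
  define P where "P x = (\<Prod>y\<in>C. real_of_int x - h y) /
    (\<Prod>y\<in>insert z C - {x}. real_of_int x - real_of_int y)" for x
  have fB: "finite B" using fin by (rule finite_subset[rotated]) (auto simp: B_def)
  have fC: "finite C" "z \<notin> C" using fB by (auto simp: C_def)
  have zB: "z \<in> B" using z low by (simp add: B_def)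
  then have BC: "insert z C = B" by (auto simp: C_def)
  have W: "W x = P x / real t" if "x \<in> {x \<in> B. x + int t \<notin> Z}" for x
  proof -
    have x: "x \<in> Z" "L \<le> x" "x + int t \<notin> Z" "int t dvd x - z" using that by (auto simp: B_def)
    have z': "L + (x - L) mod int t = z" using residue_start(5)[OF t x(2) z] x(4) by simp
    have "int t dvd y - x \<longleftrightarrow> int t dvd y - z" for y
      using dvd_add_left_iff[OF x(4), of "y - x"] by simp
    then have "{y \<in> Z. L \<le> y \<and> int t dvd y - x} = B" by (simp add: B_def)
    then show ?thesis
      using hook_prod_move_bead[OF t sub fin x(1-3)] unfolding W_def P_def h_def z' C_def by simp
  qed
  have P0: "P x = 0" if "x \<in> B - {x \<in> B. x + int t \<notin> Z}" for x
  proof -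
    have x: "x + int t \<in> Z" "L \<le> x" "int t dvd x - z" using that by (auto simp: B_def)
    have "int t dvd x + int t - z" using dvd_add_triv_right_iff[of "int t" "x - z"] x(3)
      by (simp add: algebra_simps)
    then have "x + int t \<in> C" using x z by (simp add: C_def B_def)
    moreover have "real_of_int x - h (x + int t) = 0" by (simp add: h_def)
    ultimately have "(\<Prod>y\<in>C. real_of_int x - h y) = 0" using fC(1) by (meson prod_zero)
    then show ?thesis by (simp add: P_def)
  qed
  have red: "(\<Sum>x\<in>{x \<in> B. x + int t \<notin> Z}. W x * g x) = (\<Sum>x\<in>B. P x * g x) / real t" for g
  proof -
    have "(\<Sum>x\<in>{x \<in> B. x + int t \<notin> Z}. W x * g x) = (\<Sum>x\<in>{x \<in> B. x + int t \<notin> Z}. P x * g x / real t)"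
      by (rule sum.cong) (simp_all add: W)
    also have "\<dots> = (\<Sum>x\<in>B. P x * g x / real t)"
      by (rule sum.mono_neutral_left[OF fB]) (use P0 in auto)
    finally show ?thesis by (simp add: sum_divide_distrib)
  qed
  have inj: "inj_on real_of_int (insert z C)" by (simp add: inj_on_def)
  note pf = partial_fraction_weights[OF fC inj, where h = h, folded P_def, unfolded BC]
  show "(\<Sum>x\<in>{x \<in> B. x + int t \<notin> Z}. W x) = 1 / real t"
    using red[of "\<lambda>_. 1"] pf(2) by simp
  define N S where "N = real (card B)" and "S = real_of_int (\<Sum>B)"
  have cC: "real (card C) = N - 1" using card.remove[OF fB zB] by (simp add: C_def N_def)
  have SC: "(\<Sum>y\<in>C. real_of_int y) = S - real_of_int z"
    using sum.remove[OF fB zB, of real_of_int] by (simp add: C_def S_def)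
  have "(\<Sum>j\<in>C. real_of_int j - h j) = real t * (N - 1)"
    using cC by (simp add: h_def)
  moreover have "(\<Sum>j\<in>C. (real_of_int j)\<^sup>2 - (h j)\<^sup>2) =
      2 * real t * (S - real_of_int z) - (real t)\<^sup>2 * (N - 1)"
  proof -
    have "(\<Sum>j\<in>C. (real_of_int j)\<^sup>2 - (h j)\<^sup>2) = (\<Sum>j\<in>C. 2 * real t * real_of_int j - (real t)\<^sup>2)"
      by (intro sum.cong refl) (simp add: h_def power2_eq_square algebra_simps)
    also have "\<dots> = 2 * real t * (\<Sum>j\<in>C. real_of_int j) - (real t)\<^sup>2 * real (card C)"
      by (simp add: sum_subtractf sum_distrib_left)
    finally show ?thesis by (simp only: SC cC)
  qed
  ultimately have m: "(\<Sum>x\<in>B. P x) = 1"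
    "(\<Sum>x\<in>B. P x * real_of_int x) = real_of_int z + real t * (N - 1)"
    "2 * (\<Sum>x\<in>B. P x * (real_of_int x)\<^sup>2) = (real_of_int z + real t * (N - 1))\<^sup>2 +
      (real_of_int z)\<^sup>2 + (2 * real t * (S - real_of_int z) - (real t)\<^sup>2 * (N - 1))"
    using pf(2-4) by simp_all
  define s where "s = real t - v"
  have "(\<Sum>x\<in>B. P x * (real_of_int (x + int t) - v)\<^sup>2) =
    (\<Sum>x\<in>B. P x * (real_of_int x)\<^sup>2 + 2 * s * (P x * real_of_int x) + s\<^sup>2 * P x)"
    by (intro sum.cong refl) (simp add: s_def power2_eq_square algebra_simps)
  also have "\<dots> = (\<Sum>x\<in>B. P x * (real_of_int x)\<^sup>2) +
    2 * s * (\<Sum>x\<in>B. P x * real_of_int x) + s\<^sup>2 * (\<Sum>x\<in>B. P x)"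
    by (simp only: sum.distrib sum_distrib_left)
  \<comment> \<open>The first square is the bias of the mean \<open>z + t * N\<close> of
    \<open>x + t\<close> against \<open>v\<close>; the rest is the variance. The subtracted
    expression is the sum of the \<open>N\<close> lowest positions z, z + t, ..., so the variance
    measures how far the beads are from being packed.\<close>
  also have "\<dots> = (real_of_int z + real t * N - v)\<^sup>2 +
        real t * (S - (N * real_of_int z + real t * N * (N - 1) / 2))"
    using m(3) unfolding m(1,2) by (simp add: s_def power2_eq_square field_simps)
  finally show "(\<Sum>x\<in>{x \<in> B. x + int t \<notin> Z}. W x * (real_of_int (x + int t) - v)\<^sup>2) =
      ((real_of_int z + real t * real (card B) - v)\<^sup>2 +
        real t * (real_of_int (\<Sum>B) -
          (real (card B) * real_of_int z + real t * real (card B) * (real (card B) - 1) / 2))) / real t"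
    unfolding red N_def S_def by simp
qed

text \<open>The beads of a class of the core are packed, so \<open>b\<close> comes right after the
  last of them and their sum is an arithmetic series. This identifies the mean and the reference sum
  that appear in \<open>class_transition\<close>.\<close>

lemma core_class:
  assumes core: "is_t_core t \<mu>" and t: "t > 0" and sub: "{..<L + int t} \<subseteq> beads \<mu>"
    and z: "L \<le> z" "z < L + int t" "[z = int i] (mod int t)"
  defines "B \<equiv> {y \<in> beads \<mu>. L \<le> y \<and> int t dvd y - z}"
  shows "b t \<mu> i = z + int t * int (card B)"
    and "real_of_int (\<Sum>B) = real (card B) * real_of_int z + real t * real (card B) * (real (card B) - 1) / 2"
proof -
  have low: "y \<in> beads \<mu>" if "y < L + int t" for y using sub that by auto
  have p: "is_partition \<mu>" using core by (simp add: is_t_core_def)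
  define f where "f s = z + int t * int s" for s
  have inj: "inj_on f A" for A using t by (simp add: f_def inj_on_def)
  have down: "f s \<in> beads \<mu>" if "f s' \<in> beads \<mu>" "s \<le> s'" for s s'
    using that
  proof (induction s' arbitrary: s)
    case (Suc s')
    have "f s' = f (Suc s') - int t" by (simp add: f_def algebra_simps)
    then have "f s' \<in> beads \<mu>" using is_t_core_beads[OF core t Suc.prems(1)] by simp
    then show ?case using Suc by (cases "s = Suc s'") auto
  qed simp
  have runner: "\<exists>s. y = f s" if "L \<le> y" "int t dvd y - z" for y
  proof -
    obtain k where k: "y - z = int t * k" using \<open>int t dvd y - z\<close> by (elim dvdE)
    \<comment> \<open>The cutoff alone gives only \<open>y - z > - t\<close>; divisibility sharpens
      it to \<open>y \<ge> z\<close>.\<close>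
    have "- int t < int t * k" using k z \<open>L \<le> y\<close> by linarith
    then have "int t * (-1) < int t * k" by simp
    then have "-1 < k" using t by (simp only: mult_less_cancel_left_pos of_nat_0_less_iff)
    then have "y = f (nat k)" using k by (simp add: f_def)
    then show ?thesis by blast
  qed
  have "\<exists>s. f s \<notin> beads \<mu>"
  proof (rule ccontr)
    assume "\<not> (\<exists>s. f s \<notin> beads \<mu>)"
    moreover have "L \<le> f s" for s using z(1) by (simp add: f_def add_increasing2)
    ultimately have "range f \<subseteq> {y \<in> beads \<mu>. L \<le> y}" by blast
    then have "finite (range f)" using finite_beads_ge[OF p] by (rule finite_subset)
    then show False using inj finite_imageD by blast
  qed
  define N where "N = (LEAST s. f s \<notin> beads \<mu>)"
  have N: "f N \<notin> beads \<mu>" "f s \<in> beads \<mu> \<longleftrightarrow> s < N" for s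
  proof -
    show N: "f N \<notin> beads \<mu>" unfolding N_def using \<open>\<exists>s. f s \<notin> beads \<mu>\<close> by (rule LeastI_ex)
    show "f s \<in> beads \<mu> \<longleftrightarrow> s < N"
      using N down[of s N] not_less_Least[of s "\<lambda>s. f s \<notin> beads \<mu>"] unfolding N_def[symmetric]
      by (meson down not_le)
  qed
  have BN: "B = f ` {..<N}"
  proof (intro equalityI subsetI)
    fix y assume "y \<in> B"
    then show "y \<in> f ` {..<N}" using runner[of y] N(2) by (auto simp: B_def)
  next
    fix y assume "y \<in> f ` {..<N}"
    then obtain s where s: "y = f s" "s < N" by auto
    moreover have "L \<le> f s" "int t dvd f s - z" using z(1) by (simp_all add: f_def add_increasing2)
    ultimately show "y \<in> B" using N(2) by (simp add: B_def)
  qed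
  then have cB: "card B = N" by (simp add: card_image inj)
  have "b t \<mu> i = f N"
    unfolding b_def
  proof (rule Least_equality)
    have "[f N = z] (mod int t)" by (simp add: f_def cong_def)
    then show "[f N = int i] (mod int t) \<and> seq01 \<mu> (f N) = 1"
      using z(3) N(1) cong_trans by (auto simp: seq01_eq[OF p])
  next
    fix y assume y: "[y = int i] (mod int t) \<and> seq01 \<mu> y = 1"
    then have "y \<notin> beads \<mu>" by (simp add: seq01_eq[OF p] split: if_splits)
    \<comment> \<open>There are no gaps below the cutoff, so the least gap over all integers is
      found above it.\<close>
    then have "L \<le> y" using low[of y] t by linarith
    moreover have "int t dvd y - z"
      using y z(3) by (metis cong_iff_dvd_diff cong_sym cong_trans)
    ultimately obtain s where "y = f s" using runner by blast
    then have "N \<le> s" using N(2)[of s] \<open>y \<notin> beads \<mu>\<close> by simp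
    then show "f N \<le> y" using \<open>y = f s\<close> by (simp add: f_def mult_left_mono)
  qed
  then show "b t \<mu> i = z + int t * int (card B)" by (simp add: cB f_def)
  have "real_of_int (\<Sum>(f ` {..<n})) = real n * real_of_int z + real t * real n * (real n - 1) / 2" for n
  proof (induction n)
    case (Suc n)
    have "f n \<notin> f ` {..<n}" using inj_image_mem_iff[OF inj, of n "{..<n}"] by simp
    then show ?case using Suc by (simp add: lessThan_Suc f_def[of n] field_simps)
  qed simp
  from this[of N] show "real_of_int (\<Sum>B) =
    real (card B) * real_of_int z + real t * real (card B) * (real (card B) - 1) / 2"
    unfolding BN[symmetric] cB .
qed

section \<open>Invariants along a chain of added hooks\<close>

lemma hook_ge_partition:
  assumes "hook_ge t \<nu> \<mu>" "is_partition \<mu>"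
  shows "is_partition \<nu>"
  using assms(1) unfolding hook_ge_def
  by (induction rule: rtranclp_induct) (use assms(2) in \<open>auto simp: adds_hook_def\<close>)

lemma hook_ge_sum_list:
  assumes "hook_ge t \<nu> \<mu>"
  shows "sum_list \<mu> \<le> sum_list \<nu>"
  using assms unfolding hook_ge_def
  by (induction rule: rtranclp_induct) (auto dest: sum_list_add_hook)

text \<open>A cutoff below which \<open>\<nu>\<close> has no gaps also works for everything between \<open>\<mu>\<close> and \<open>\<nu>\<close>, which
  makes charge and energy of each residue class finite quantities.\<close>

lemma hook_ge_beads:
  assumes "hook_ge t \<nu> \<mu>" "is_partition \<mu>" "t > 0" "{..<L} \<subseteq> beads \<nu>"
  shows "{..<L} \<subseteq> beads \<mu> \<and>
    (\<forall>z. card {y \<in> beads \<nu>. L \<le> y \<and> int t dvd y - z} = card {y \<in> beads \<mu>. L \<le> y \<and> int t dvd y - z}) \<and>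
    \<Sum>{y \<in> beads \<nu>. L \<le> y} = \<Sum>{y \<in> beads \<mu>. L \<le> y} + (int (sum_list \<nu>) - int (sum_list \<mu>))"
  using assms(1,4) unfolding hook_ge_def
proof (induction rule: rtranclp_induct)
  case (step \<kappa> \<nu>)
  obtain x where x: "is_partition \<kappa>" "x \<in> beads \<kappa>" "x + int t \<notin> beads \<kappa>"
    "beads \<nu> = insert (x + int t) (beads \<kappa> - {x})"
    using step.hyps(2) by (auto simp: adds_hook_iff)
  have "x \<notin> beads \<nu>" using x assms(3) by simp
  \<comment> \<open>The position that the bead leaves is a gap of \<open>\<nu>\<close>, hence not
    below the cutoff; the moving bead is among those counted.\<close>
  then have Lx: "L \<le> x" using step.prems by (auto simp: not_less[symmetric])
  have low: "{..<L} \<subseteq> beads \<kappa>"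
    using step.prems Lx unfolding x(4) by auto
  note IH = step.IH[OF low]
  define E where "E Q = {y \<in> beads \<kappa>. L \<le> y \<and> Q y}" for Q
  have fin: "finite (E Q)" for Q
    using finite_beads_ge[OF x(1), of L] by (rule finite_subset[rotated]) (auto simp: E_def)
  have E: "{y \<in> beads \<nu>. L \<le> y \<and> Q y} = (if Q x then insert (x + int t) (E Q - {x}) else E Q)"
    if "Q (x + int t) \<longleftrightarrow> Q x" for Q
    using that Lx x(2,3) unfolding x(4) E_def by auto
  have xt: "x + int t \<notin> E Q" for Q using x(3) by (simp add: E_def)
  have xE: "x \<in> E Q" if "Q x" for Q using x(2) Lx that by (simp add: E_def)
  have "card {y \<in> beads \<nu>. L \<le> y \<and> int t dvd y - z} = card {y \<in> beads \<kappa>. L \<le> y \<and> int t dvd y - z}" for z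
  proof -
    have "int t dvd x + int t - z \<longleftrightarrow> int t dvd x - z"
      using dvd_add_triv_right_iff[of "int t" "x - z"] by (simp add: algebra_simps)
    from E[of "\<lambda>y. int t dvd y - z", OF this] show ?thesis
      using card_exchange[OF fin xE xt, of "\<lambda>y. int t dvd y - z"] by (simp add: E_def split: if_splits)
  qed
  moreover have "\<Sum>{y \<in> beads \<nu>. L \<le> y} = \<Sum>{y \<in> beads \<kappa>. L \<le> y} + int t"
  proof -
    let ?E = "E (\<lambda>_. True)"
    have e: "x \<in> ?E" "x + int t \<notin> ?E" "finite ?E" using xE xt fin by simp_all
    have "\<Sum>(insert (x + int t) (?E - {x})) = \<Sum>?E + int t"
      using e sum.remove[OF e(3,1), of "\<lambda>y. y"] by simp
    then show ?thesis using E[of "\<lambda>_. True"] by (simp add: E_def)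
  qed
  ultimately show ?case
    using IH sum_list_add_hook[OF step.hyps(2)] by simp
qed simp

subsection \<open>Summation over the chains of added hooks\<close>

lemma hook_ge_refl: "hook_ge t \<nu> \<nu>"
  by (simp add: hook_ge_def)

lemma hook_ge_step: "hook_ge t \<kappa> \<mu> \<Longrightarrow> adds_hook t \<kappa> \<nu> \<Longrightarrow> hook_ge t \<nu> \<mu>"
  unfolding hook_ge_def by (rule rtranclp.rtrancl_into_rtrancl)

lemma hook_ge_same_size:
  assumes "hook_ge t \<nu> \<mu>" "sum_list \<nu> = sum_list \<mu>" "t > 0"
  shows "\<nu> = \<mu>"
  using assms(1) unfolding hook_ge_def
proof (cases rule: rtranclp.cases)
  case (rtrancl_into_rtrancl \<kappa>)
  then have "sum_list \<mu> \<le> sum_list \<kappa>" "sum_list \<nu> = sum_list \<kappa> + t"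
    using hook_ge_sum_list[of t \<kappa> \<mu>] sum_list_add_hook[of t \<kappa> \<nu>] by (auto simp: hook_ge_def)
  then show ?thesis using assms(2,3) by simp
qed simp

text \<open>Every step raises the size by \<open>t > 0\<close>, so a chain with total increase
  \<open>t\<close> is a single step. The recursion of \<open>F\<close> thus runs over the one-hook
  predecessors.\<close>

lemma hook_ge_one_step_iff:
  assumes "t > 0"
  shows "hook_ge t \<nu> \<kappa> \<and> sum_list \<nu> = sum_list \<kappa> + t \<longleftrightarrow> adds_hook t \<kappa> \<nu>"
proof
  assume *: "hook_ge t \<nu> \<kappa> \<and> sum_list \<nu> = sum_list \<kappa> + t"
  then have "(adds_hook t)\<^sup>*\<^sup>* \<kappa> \<nu>" by (simp add: hook_ge_def)
  then show "adds_hook t \<kappa> \<nu>"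
  proof (cases rule: converse_rtranclpE)
    case (step \<kappa>')
    then have "hook_ge t \<nu> \<kappa>'" "sum_list \<kappa>' = sum_list \<nu>"
      using * sum_list_add_hook[of t \<kappa> \<kappa>'] by (simp_all add: hook_ge_def)
    then have "\<nu> = \<kappa>'" using hook_ge_same_size[OF _ _ assms] by simp
    then show ?thesis using step by simp
  qed (use * assms in simp)
next
  assume *: "adds_hook t \<kappa> \<nu>"
  then show "hook_ge t \<nu> \<kappa> \<and> sum_list \<nu> = sum_list \<kappa> + t"
    using hook_ge_step[OF hook_ge_refl *] sum_list_add_hook[OF *] by simp
qed

text \<open>Turns sums over the partitions one hook above \<open>\<kappa>\<close> into sums over its
  movable beads. Different beads give different partitions because each leaves its own position
  empty.\<close>

lemma ex_move_bead_bij: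
  assumes "is_partition \<kappa>" "t > 0"
  obtains M where "bij_betw M {x \<in> beads \<kappa>. x + int t \<notin> beads \<kappa>} {\<nu>. adds_hook t \<kappa> \<nu>}"
    "\<forall>x\<in>{x \<in> beads \<kappa>. x + int t \<notin> beads \<kappa>}.
      is_partition (M x) \<and> beads (M x) = insert (x + int t) (beads \<kappa> - {x})"
proof -
  let ?A = "{x \<in> beads \<kappa>. x + int t \<notin> beads \<kappa>}"
  have "\<forall>x\<in>?A. \<exists>\<nu>. is_partition \<nu> \<and> beads \<nu> = insert (x + int t) (beads \<kappa> - {x})"
    using move_bead_partition[OF assms(1)] by blast
  then obtain M where M: "\<And>x. x \<in> ?A \<Longrightarrow>
      is_partition (M x) \<and> beads (M x) = insert (x + int t) (beads \<kappa> - {x})"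
    by metis
  have "inj_on M ?A"
  proof (rule inj_onI, rule ccontr)
    fix x y assume xy: "x \<in> ?A" "y \<in> ?A" "M x = M y" "x \<noteq> y"
    have "y \<in> beads (M x)" using M[OF xy(1)] xy(2,4) by auto
    moreover have "y \<notin> beads (M y)" using M[OF xy(2)] assms(2) by auto
    ultimately show False using xy(3) by simp
  qed
  moreover have "M ` ?A = {\<nu>. adds_hook t \<kappa> \<nu>}"
  proof (intro equalityI subsetI)
    fix \<nu> assume "\<nu> \<in> M ` ?A"
    then show "\<nu> \<in> {\<nu>. adds_hook t \<kappa> \<nu>}" using M assms(1) by (auto simp: adds_hook_iff)
  next
    fix \<nu> assume "\<nu> \<in> {\<nu>. adds_hook t \<kappa> \<nu>}"
    then obtain x where x: "is_partition \<nu>" "x \<in> ?A" "beads \<nu> = insert (x + int t) (beads \<kappa> - {x})"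
      by (auto simp: adds_hook_iff)
    then have "\<nu> = M x" using M[OF x(2)] beads_inj[OF x(1), of "M x"] by simp
    then show "\<nu> \<in> M ` ?A" using x(2) by blast
  qed
  ultimately have "bij_betw M ?A {\<nu>. adds_hook t \<kappa> \<nu>}" by (simp add: bij_betw_def)
  with that M show thesis by blast
qed

lemma finite_addable:
  assumes "is_partition \<kappa>"
  shows "finite {x \<in> beads \<kappa>. x + int t \<notin> beads \<kappa>}"
proof (rule finite_subset)
  show "{x \<in> beads \<kappa>. x + int t \<notin> beads \<kappa>} \<subseteq>
    {y \<in> beads \<kappa>. - int (length \<kappa>) - int t \<le> y}"
    using beads_below[of _ \<kappa>] by force
qed (rule finite_beads_ge[OF assms])

section \<open>Expected change in one step\<close>

definition content_square_sum :: "nat \<Rightarrow> nat \<Rightarrow> nat list \<Rightarrow> real" where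
  "content_square_sum t k \<nu> =
    (\<Sum>c \<in> {c \<in> diagram \<nu>. [content c = int k] (mod int t)}. real_of_int ((content c)\<^sup>2))"

lemma content_square_sum_add_hook:
  fixes i' :: "nat \<Rightarrow> int"
  assumes "is_partition \<kappa>" "is_partition \<nu>" "x \<in> beads \<kappa>" "x + int t \<notin> beads \<kappa>"
    "beads \<nu> = insert (x + int t) (beads \<kappa> - {x})"
    and i: "[x = int i] (mod int t)" "0 \<le> i' i" "i' i \<le> int t - 1" "[int i - i' i = int k] (mod int t)"
  shows "content_square_sum t k \<nu> =
    content_square_sum t k \<kappa> + (real_of_int (x + int t) - real_of_int (i' i))\<^sup>2"
proof -
  define g where "g c = (if [c = int k] (mod int t) then real_of_int (c\<^sup>2) else 0)" for c
  have g: "content_square_sum t k \<nu> = (\<Sum>q \<in> diagram \<nu>. g (content q))" for \<nu>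
    unfolding content_square_sum_def g_def
    by (rule sum.mono_neutral_cong_left[OF finite_diagram]) auto
  define m where "m = x + int t - i' i"
  have "[m = int k] (mod int t)"
  proof -
    have "[x + int t - i' i = int i - i' i] (mod int t)"
      using i(1) by (intro cong_diff) (simp_all add: cong_def)
    then show ?thesis using i(4) cong_trans unfolding m_def by blast
  qed
  then have eq: "[c = int k] (mod int t) \<longleftrightarrow> c = m" if "c \<in> {x + 1..x + int t}" for c
  proof -
    have "c = m" if "[c = int k] (mod int t)"
    proof -
      have "int t dvd c - m" using that \<open>[m = int k] (mod int t)\<close> by (metis cong_iff_dvd_diff cong_sym cong_trans)
      moreover have "\<bar>c - m\<bar> < \<bar>int t\<bar>" using \<open>c \<in> _\<close> i(2,3) by (auto simp: m_def)
      ultimately show ?thesis using dvd_imp_le_int[of "c - m" "int t"] by linarith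
    qed
    then show ?thesis using \<open>[m = int k] (mod int t)\<close> by blast
  qed
  have "m \<in> {x + 1..x + int t}" using i(2,3) by (auto simp: m_def)
  then have "(\<Sum>c \<in> {x + 1..x + int t}. g c) = (\<Sum>c \<in> {m}. g c)"
    by (intro sum.mono_neutral_right) (auto simp: g_def eq)
  also have "\<dots> = (real_of_int (x + int t) - real_of_int (i' i))\<^sup>2"
    using \<open>[m = int k] (mod int t)\<close> by (simp add: g_def m_def)
  finally show ?thesis unfolding g sum_content_add_hook[OF assms(1-5), of g] by simp
qed

lemma sum_G_add_hook:
  fixes i' :: "nat \<Rightarrow> int"
  assumes t: "t > 0" and core: "is_t_core t \<mu>" and ge: "hook_ge t \<kappa> \<mu>"
    and size: "sum_list \<kappa> = sum_list \<mu> + n * t"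
    and i': "\<And>i. i \<le> t - 1 \<Longrightarrow>
           0 \<le> i' i \<and> i' i \<le> int t - 1 \<and> [int i - i' i = int k] (mod int t)"
  shows "(\<Sum>\<nu> | adds_hook t \<kappa> \<nu>. G t \<nu>) = G t \<kappa>"
    and "(\<Sum>\<nu> | adds_hook t \<kappa> \<nu>. G t \<nu> * content_square_sum t k \<nu>) =
      G t \<kappa> * (content_square_sum t k \<kappa>
        + real_of_int (\<Sum>i = 0..t - 1. (b t \<mu> i - i' i)\<^sup>2) / real t + real t * real n)"
proof -
  have p\<mu>: "is_partition \<mu>" using core by (simp add: is_t_core_def)
  have p: "is_partition \<kappa>" by (rule hook_ge_partition[OF ge p\<mu>])
  define Z where "Z = beads \<kappa>"
  \<comment> \<open>The extra \<open>t\<close> keeps the whole window from \<open>L\<close> to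
    \<open>L + t\<close> occupied, so each residue class retains at least one bead, its lowest
    position.\<close>
  define L where "L = - int (length \<kappa>) - int t"
  have low: "{..<L + int t} \<subseteq> Z" by (auto simp: Z_def L_def beads_below)
  have low0: "{..<L} \<subseteq> Z"
  proof -
    have "{..<L} \<subseteq> {..<L + int t}" by simp
    then show ?thesis using low by (rule subset_trans)
  qed
  have fin: "finite {y \<in> Z. L \<le> y}" unfolding Z_def by (rule finite_beads_ge[OF p])
  have low\<mu>: "{..<L + int t} \<subseteq> beads \<mu>"
    using hook_ge_beads[OF ge p\<mu> t low[unfolded Z_def]] by blast
  note inv = hook_ge_beads[OF ge p\<mu> t, folded Z_def, OF low0]
  define A where "A = {x \<in> Z. x + int t \<notin> Z}"
  have fA: "finite A" unfolding A_def Z_def by (rule finite_addable[OF p])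
  have LA: "L \<le> x" if "x \<in> A" for x 
  proof (rule ccontr)
    assume "\<not> L \<le> x"
    then have "x + int t \<in> Z" using low by auto
    then show False using that by (simp add: A_def)
  qed
  define z where "z i = L + (int i - L) mod int t" for i
  have z: "L \<le> z i" "z i < L + int t" "[z i = int i] (mod int t)" for i
    using t by (simp_all add: z_def cong_def mod_add_right_eq)
  define B where "B i = {y \<in> Z. L \<le> y \<and> int t dvd y - z i}" for i
  define W where "W x = hook_prod t Z / hook_prod t (insert (x + int t) (Z - {x}))" for x
  define r where "r x = nat (x mod int t)" for x
  have r: "r x = i \<longleftrightarrow> int t dvd x - z i" if "i < t" for x i
  proof -
    have "0 \<le> x mod int t" using t by simp
    then have "r x = i \<longleftrightarrow> x mod int t = int i" unfolding r_def by linarith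
    also have "\<dots> \<longleftrightarrow> [x = int i] (mod int t)" using that by (simp add: cong_def)
    also have "\<dots> \<longleftrightarrow> [x = z i] (mod int t)" using z(3)[of i] by (metis cong_sym cong_trans)
    finally show ?thesis by (simp add: cong_iff_dvd_diff)
  qed
  have rt: "r x < t" for x using t by (simp add: r_def nat_less_iff)
  have xr: "[x = int (r x)] (mod int t)" for x using t by (simp add: r_def cong_def)
  have I: "{0..t - 1} = {..<t}" using t by auto
  have group: "(\<Sum>x\<in>A. f x) = (\<Sum>i<t. \<Sum>x\<in>{x \<in> B i. x + int t \<notin> Z}. f x)" for f :: "int \<Rightarrow> real"
  proof -
    have "(\<Sum>x\<in>A. f x) = (\<Sum>i<t. \<Sum>x\<in>{x \<in> A. r x = i}. f x)"
      by (rule sum.group[symmetric]) (use fA rt in auto)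
    also have "\<dots> = (\<Sum>i<t. \<Sum>x\<in>{x \<in> B i. x + int t \<notin> Z}. f x)"
    proof (rule sum.cong[OF refl])
      fix i assume "i \<in> {..<t}"
      then have "{x \<in> A. r x = i} = {x \<in> B i. x + int t \<notin> Z}"
        using LA r[of i] by (auto simp: A_def B_def)
      then show "(\<Sum>x\<in>{x \<in> A. r x = i}. f x) = (\<Sum>x\<in>{x \<in> B i. x + int t \<notin> Z}. f x)" by simp
    qed
    finally show ?thesis .
  qed
  note trans = class_transition[OF t low fin z(1,2), folded B_def, folded W_def]
  obtain M where M: "bij_betw M A {\<nu>. adds_hook t \<kappa> \<nu>}"
    "\<forall>x\<in>A. is_partition (M x) \<and> beads (M x) = insert (x + int t) (Z - {x})"
    by (rule ex_move_bead_bij[OF p t, folded Z_def, folded A_def])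
  have MA: "is_partition (M x)" "beads (M x) = insert (x + int t) (Z - {x})"
    "x \<in> Z" "x + int t \<notin> Z" if "x \<in> A" for x
    using that M(2) by (auto simp: A_def)
  have "Z = {y \<in> Z. L \<le> y} \<union> {..<L}" using low0 by (auto simp: not_less)
  then have "hook_prod t Z \<noteq> 0"
    by (rule hook_prod_nonzero[OF fin, rotated]) blast
  then have GM: "G t (M x) = G t \<kappa> * W x" if "x \<in> A" for x
    using G_eq_hook_prod[OF MA(1)[OF that], of t] G_eq_hook_prod[OF p, of t, folded Z_def]
    by (simp add: W_def MA(2)[OF that])
  have "(\<Sum>x\<in>A. W x) = 1" using t by (simp add: group trans(1))
  then show 1: "(\<Sum>\<nu> | adds_hook t \<kappa> \<nu>. G t \<nu>) = G t \<kappa>"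
    unfolding sum.reindex_bij_betw[OF M(1), symmetric] by (simp add: GM flip: sum_distrib_left)
  have qM: "content_square_sum t k (M x) =
    content_square_sum t k \<kappa> + (real_of_int (x + int t) - real_of_int (i' (r x)))\<^sup>2" if "x \<in> A" for x
  proof -
    have "r x \<le> t - 1" using rt[of x] by linarith
    note i = i'[OF this]
    show ?thesis
      using content_square_sum_add_hook[OF p MA(1)[OF that] MA(3,4,2)[OF that, unfolded Z_def] xr] i
      by blast
  qed
  \<comment> \<open>By \<open>core_class\<close>, the subtracted expression is the sum over the same
    class in \<open>\<mu>\<close>, so \<open>s i\<close> is the displacement of class
    \<open>i\<close> from the core.\<close>
  define s where "s i = real_of_int (\<Sum>(B i)) -
    (real (card (B i)) * real_of_int (z i) + real t * real (card (B i)) * (real (card (B i)) - 1) / 2)" for i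
  have cB: "card {y \<in> beads \<mu>. L \<le> y \<and> int t dvd y - z i} = card (B i)" for i
    using inv by (simp add: B_def)
  have b: "real_of_int (b t \<mu> i) = real_of_int (z i) + real t * real (card (B i))" for i
    using core_class(1)[OF core t low\<mu> z] cB by simp
  have s: "s i = real_of_int (\<Sum>(B i)) - real_of_int (\<Sum>{y \<in> beads \<mu>. L \<le> y \<and> int t dvd y - z i})" for i
    using core_class(2)[OF core t low\<mu> z] cB by (simp add: s_def)
  have cls: "(\<Sum>i<t. \<Sum>{y \<in> Y. L \<le> y \<and> int t dvd y - z i}) = \<Sum>{y \<in> Y. L \<le> y}"
    if "finite {y \<in> Y. L \<le> y}" for Y
  proof -
    have "(\<Sum>i<t. \<Sum>{y \<in> Y. L \<le> y \<and> int t dvd y - z i}) = (\<Sum>i<t. \<Sum>{y \<in> {y \<in> Y. L \<le> y}. r y = i})"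
      by (intro sum.cong refl) (auto simp: r)
    also have "\<dots> = \<Sum>{y \<in> Y. L \<le> y}"
      by (rule sum.group) (use that rt in auto)
    finally show ?thesis .
  qed
  have "(\<Sum>i<t. s i) = real_of_int (\<Sum>{y \<in> Z. L \<le> y}) - real_of_int (\<Sum>{y \<in> beads \<mu>. L \<le> y})"
    unfolding s sum_subtractf of_int_sum[symmetric] B_def
    using cls[OF fin] cls[OF finite_beads_ge[OF p\<mu>]] by simp
  also have "\<dots> = real n * real t" using inv size by simp
  finally have ssum: "(\<Sum>i<t. s i) = real n * real t" .
  have "(\<Sum>x\<in>A. W x * (real_of_int (x + int t) - real_of_int (i' (r x)))\<^sup>2) =
    (\<Sum>i<t. ((real_of_int (b t \<mu> i) - real_of_int (i' i))\<^sup>2 + real t * s i) / real t)"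
    unfolding group
  proof (rule sum.cong[OF refl])
    fix i assume i: "i \<in> {..<t}"
    then have "r x = i" if "x \<in> B i" for x using r[of i x] that by (simp add: B_def)
    then have "(\<Sum>x\<in>{x \<in> B i. x + int t \<notin> Z}. W x * (real_of_int (x + int t) - real_of_int (i' (r x)))\<^sup>2) =
      (\<Sum>x\<in>{x \<in> B i. x + int t \<notin> Z}. W x * (real_of_int (x + int t) - real_of_int (i' i))\<^sup>2)"
      by (intro sum.cong[OF refl]) (metis (no_types, lifting) mem_Collect_eq)
    also have "\<dots> = ((real_of_int (b t \<mu> i) - real_of_int (i' i))\<^sup>2 + real t * s i) / real t"
      unfolding b s_def by (rule trans(2))
    finally show "(\<Sum>x\<in>{x \<in> B i. x + int t \<notin> Z}. W x * (real_of_int (x + int t) - real_of_int (i' (r x)))\<^sup>2) =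
      ((real_of_int (b t \<mu> i) - real_of_int (i' i))\<^sup>2 + real t * s i) / real t" .
  qed
  also have "\<dots> = real_of_int (\<Sum>i = 0..t - 1. (b t \<mu> i - i' i)\<^sup>2) / real t + real t * real n"
    unfolding sum_divide_distrib[symmetric] sum.distrib sum_distrib_left[symmetric] ssum I
    using t by (simp add: add_divide_distrib)
  finally have 2: "(\<Sum>x\<in>A. W x * (real_of_int (x + int t) - real_of_int (i' (r x)))\<^sup>2) =
    real_of_int (\<Sum>i = 0..t - 1. (b t \<mu> i - i' i)\<^sup>2) / real t + real t * real n" .
  have "(\<Sum>\<nu> | adds_hook t \<kappa> \<nu>. G t \<nu> * content_square_sum t k \<nu>) =
    (\<Sum>x\<in>A. G t \<kappa> * (W x * content_square_sum t k \<kappa> +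
      W x * (real_of_int (x + int t) - real_of_int (i' (r x)))\<^sup>2))"
    unfolding sum.reindex_bij_betw[OF M(1), symmetric]
    by (intro sum.cong refl) (simp only: GM qM distrib_left mult.assoc)
  also have "\<dots> = G t \<kappa> * ((\<Sum>x\<in>A. W x) * content_square_sum t k \<kappa> +
      (\<Sum>x\<in>A. W x * (real_of_int (x + int t) - real_of_int (i' (r x)))\<^sup>2))"
    unfolding sum_distrib_left[symmetric] sum.distrib sum_distrib_right[symmetric] ..
  finally show "(\<Sum>\<nu> | adds_hook t \<kappa> \<nu>. G t \<nu> * content_square_sum t k \<nu>) =
      G t \<kappa> * (content_square_sum t k \<kappa>
        + real_of_int (\<Sum>i = 0..t - 1. (b t \<mu> i - i' i)\<^sup>2) / real t + real t * real n)"
    unfolding 2 \<open>(\<Sum>x\<in>A. W x) = 1\<close> by simp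
qed

section \<open>Levels above the core and induction on the number of hooks\<close>

definition hook_level :: "nat \<Rightarrow> nat list \<Rightarrow> nat \<Rightarrow> nat list set" where
  "hook_level t \<mu> n = {\<nu>. hook_ge t \<nu> \<mu> \<and> sum_list \<nu> = sum_list \<mu> + n * t}"

lemma hook_level_0: "t > 0 \<Longrightarrow> hook_level t \<mu> 0 = {\<mu>}"
  using hook_ge_same_size by (auto simp: hook_level_def hook_ge_refl)

lemma hook_level_Suc:
  assumes "t > 0" "\<nu> \<in> hook_level t \<mu> (Suc n)"
  shows "F t \<nu> \<mu> = (\<Sum>\<kappa> \<in> {\<kappa> \<in> hook_level t \<mu> n. adds_hook t \<kappa> \<nu>}. F t \<kappa> \<mu>)"
    and "\<exists>\<kappa> \<in> hook_level t \<mu> n. adds_hook t \<kappa> \<nu>"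
proof -
  have ne: "\<nu> \<noteq> \<mu>" using assms by (auto simp: hook_level_def)
  have "{\<kappa>. 0 < t \<and> hook_ge t \<nu> \<kappa> \<and> hook_ge t \<kappa> \<mu> \<and> sum_list \<nu> = sum_list \<kappa> + t} =
    {\<kappa> \<in> hook_level t \<mu> n. adds_hook t \<kappa> \<nu>}"
    using assms hook_ge_one_step_iff[OF assms(1), of \<nu>] by (auto simp: hook_level_def)
  then show "F t \<nu> \<mu> = (\<Sum>\<kappa> \<in> {\<kappa> \<in> hook_level t \<mu> n. adds_hook t \<kappa> \<nu>}. F t \<kappa> \<mu>)"
    using ne by (simp add: F.simps[of t \<nu> \<mu>])
  have "(adds_hook t)\<^sup>*\<^sup>* \<mu> \<nu>" using assms(2) by (simp add: hook_level_def hook_ge_def)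
  then obtain \<kappa> where \<kappa>: "(adds_hook t)\<^sup>*\<^sup>* \<mu> \<kappa>" "adds_hook t \<kappa> \<nu>"
    using ne by (metis rtranclp.cases)
  then have "\<kappa> \<in> hook_level t \<mu> n"
    using sum_list_add_hook[OF \<kappa>(2)] assms(2) by (simp add: hook_level_def hook_ge_def)
  then show "\<exists>\<kappa> \<in> hook_level t \<mu> n. adds_hook t \<kappa> \<nu>" using \<kappa>(2) by blast
qed

lemma adds_hook_level:
  "\<kappa> \<in> hook_level t \<mu> n \<Longrightarrow> adds_hook t \<kappa> \<nu> \<Longrightarrow> \<nu> \<in> hook_level t \<mu> (Suc n)"
  using hook_ge_step[of t \<kappa> \<mu> \<nu>] sum_list_add_hook[of t \<kappa> \<nu>] by (simp add: hook_level_def)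

lemma finite_adds_hook: "t > 0 \<Longrightarrow> finite {\<nu>. adds_hook t \<kappa> \<nu>}"
proof (cases "is_partition \<kappa>")
  case True
  assume "t > 0"
  obtain M where "bij_betw M {x \<in> beads \<kappa>. x + int t \<notin> beads \<kappa>} {\<nu>. adds_hook t \<kappa> \<nu>}"
    by (rule ex_move_bead_bij[OF True \<open>t > 0\<close>])
  then show ?thesis using finite_addable[OF True, of t] by (simp only: bij_betw_finite)
qed (simp add: adds_hook_def)

text \<open>Guards against the convention that a sum over an infinite set is 0; it also licenses the
  exchange of summations between levels.\<close>

lemma finite_hook_level: "t > 0 \<Longrightarrow> finite (hook_level t \<mu> n)"
proof (induction n)
  case (Suc n)
  have "hook_level t \<mu> (Suc n) \<subseteq> (\<Union>\<kappa>\<in>hook_level t \<mu> n. {\<nu>. adds_hook t \<kappa> \<nu>})"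
    using hook_level_Suc(2)[OF Suc.prems] by blast
  moreover have "finite (\<Union>\<kappa>\<in>hook_level t \<mu> n. {\<nu>. adds_hook t \<kappa> \<nu>})"
    using Suc finite_adds_hook[OF Suc.prems] by (intro finite_UN_I)
  ultimately show ?case by (rule finite_subset)
qed (simp add: hook_level_0)

text \<open>Summing over the edges between two levels in the other order turns the recursion of
  \<open>F\<close>, which looks down, into sums over the partitions one hook higher, which
  \<open>sum_G_add_hook\<close> evaluates.\<close>

lemma sum_hook_level_Suc:
  fixes g :: "nat list \<Rightarrow> real"
  assumes "t > 0"
  shows "(\<Sum>\<nu>\<in>hook_level t \<mu> (Suc n). real (F t \<nu> \<mu>) * g \<nu>) =
    (\<Sum>\<kappa>\<in>hook_level t \<mu> n. real (F t \<kappa> \<mu>) * (\<Sum>\<nu> | adds_hook t \<kappa> \<nu>. g \<nu>))"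
proof -
  have "(\<Sum>\<nu>\<in>hook_level t \<mu> (Suc n). real (F t \<nu> \<mu>) * g \<nu>) =
    (\<Sum>\<nu>\<in>hook_level t \<mu> (Suc n). \<Sum>\<kappa>\<in>{\<kappa> \<in> hook_level t \<mu> n. adds_hook t \<kappa> \<nu>}. real (F t \<kappa> \<mu>) * g \<nu>)"
    by (intro sum.cong refl) (simp add: hook_level_Suc(1)[OF assms] sum_distrib_right)
  also have "\<dots> = (\<Sum>\<kappa>\<in>hook_level t \<mu> n. \<Sum>\<nu>\<in>{\<nu> \<in> hook_level t \<mu> (Suc n). adds_hook t \<kappa> \<nu>}. real (F t \<kappa> \<mu>) * g \<nu>)"
    by (rule sum.swap_restrict) (use finite_hook_level[OF assms] in auto)
  also have "\<dots> = (\<Sum>\<kappa>\<in>hook_level t \<mu> n. real (F t \<kappa> \<mu>) * (\<Sum>\<nu> | adds_hook t \<kappa> \<nu>. g \<nu>))"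
  proof (rule sum.cong[OF refl])
    fix \<kappa> assume "\<kappa> \<in> hook_level t \<mu> n"
    then have "{\<nu> \<in> hook_level t \<mu> (Suc n). adds_hook t \<kappa> \<nu>} = {\<nu>. adds_hook t \<kappa> \<nu>}"
      using adds_hook_level by blast
    then show "(\<Sum>\<nu>\<in>{\<nu> \<in> hook_level t \<mu> (Suc n). adds_hook t \<kappa> \<nu>}. real (F t \<kappa> \<mu>) * g \<nu>) =
      real (F t \<kappa> \<mu>) * (\<Sum>\<nu> | adds_hook t \<kappa> \<nu>. g \<nu>)"
      by (simp add: sum_distrib_left)
  qed
  finally show ?thesis .
qed

lemma F_self: "F t \<mu> \<mu> = 1"
  by (simp add: F.simps)

lemma G_core: "is_t_core t \<mu> \<Longrightarrow> G t \<mu> = 1"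
proof -
  assume "is_t_core t \<mu>"
  then have "filter_mset (\<lambda>h. t dvd h) (hook_lengths \<mu>) = {#}"
    by (simp add: is_t_core_def)
  then show ?thesis unfolding G_def by (simp only:) simp
qed

theorem theorem6p3:
  fixes t k n :: nat and \<mu> :: "nat list" and i' :: "nat \<Rightarrow> int"
  assumes "t > 0"
    and "is_t_core t \<mu>"
    and "k \<le> t - 1"
    and "\<And>i. i \<le> t - 1 \<Longrightarrow>
           0 \<le> i' i \<and> i' i \<le> int t - 1 \<and> [int i - i' i = int k] (mod int t)"
  shows "(\<Sum>\<nu> \<in> {\<nu>. is_partition \<nu> \<and> has_t_core t \<nu> \<mu> \<and> sum_list \<nu> = sum_list \<mu> + n * t}.
            real (F t \<nu> \<mu>) * G t \<nu> *
            (\<Sum>c \<in> {c \<in> diagram \<nu>. [content c = int k] (mod int t)}. real_of_int ((content c)\<^sup>2)))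
       = real t * real (n choose 2)
         + 1 / real t * real_of_int (\<Sum>i = 0..t - 1. (b t \<mu> i - i' i)\<^sup>2) * real n
         + (\<Sum>c \<in> {c \<in> diagram \<mu>. [content c = int k] (mod int t)}. real_of_int ((content c)\<^sup>2))"
proof -
  note t = assms(1) and core = assms(2) and i' = assms(4)
  have p: "is_partition \<mu>" using core by (simp add: is_t_core_def)
  \<comment> \<open>An added hook leaves a gap \<open>t\<close> below a bead, which a core does not
    have. Being a core in terms of hook lengths thus implies minimality in the order, and the
    summation set becomes a level.\<close>
  have "\<not> adds_hook t \<kappa> \<mu>" for \<kappa>
  proof
    assume "adds_hook t \<kappa> \<mu>"
    then obtain x where x: "x \<in> beads \<kappa>" "x + int t \<notin> beads \<kappa>"
      "beads \<mu> = insert (x + int t) (beads \<kappa> - {x})"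
      by (auto simp: adds_hook_iff)
    then show False using is_t_core_beads[OF core t, of "x + int t"] t by auto
  qed
  then have level: "{\<nu>. is_partition \<nu> \<and> has_t_core t \<nu> \<mu> \<and> sum_list \<nu> = sum_list \<mu> + n * t} =
    hook_level t \<mu> n"
    using hook_ge_partition[OF _ p] by (auto simp: hook_level_def has_t_core_def)
  define q where "q = content_square_sum t k"
  define K where "K = real_of_int (\<Sum>i = 0..t - 1. (b t \<mu> i - i' i)\<^sup>2) / real t"
  have step: "(\<Sum>\<nu> | adds_hook t \<kappa> \<nu>. G t \<nu>) = G t \<kappa>"
    "(\<Sum>\<nu> | adds_hook t \<kappa> \<nu>. G t \<nu> * q \<nu>) = G t \<kappa> * (q \<kappa> + K + real t * real n)"
    if "\<kappa> \<in> hook_level t \<mu> n" for \<kappa> n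
  proof -
    have \<kappa>: "hook_ge t \<kappa> \<mu>" "sum_list \<kappa> = sum_list \<mu> + n * t"
      using that by (auto simp: hook_level_def)
    show "(\<Sum>\<nu> | adds_hook t \<kappa> \<nu>. G t \<nu>) = G t \<kappa>"
      by (rule sum_G_add_hook(1)[OF t core \<kappa> i'])
    show "(\<Sum>\<nu> | adds_hook t \<kappa> \<nu>. G t \<nu> * q \<nu>) = G t \<kappa> * (q \<kappa> + K + real t * real n)"
      unfolding q_def K_def by (rule sum_G_add_hook(2)[OF t core \<kappa> i'])
  qed
  \<comment> \<open>Total mass 1 on each level is what lets the constant
    \<open>K + real t * real n\<close> enter the induction below unweighted.\<close>
  have total: "(\<Sum>\<nu>\<in>hook_level t \<mu> n. real (F t \<nu> \<mu>) * G t \<nu>) = 1" for n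
  proof (induction n)
    case 0
    show ?case by (simp add: hook_level_0[OF t] F_self G_core[OF core])
  next
    case (Suc n)
    then show ?case by (simp add: sum_hook_level_Suc[OF t] step(1))
  qed
  have "(\<Sum>\<nu>\<in>hook_level t \<mu> n. real (F t \<nu> \<mu>) * (G t \<nu> * q \<nu>)) =
    real t * real (n choose 2) + K * real n + q \<mu>"
  proof (induction n)
    case 0
    show ?case by (simp add: hook_level_0[OF t] F_self G_core[OF core])
  next
    case (Suc n)
    have "(\<Sum>\<nu>\<in>hook_level t \<mu> (Suc n). real (F t \<nu> \<mu>) * (G t \<nu> * q \<nu>)) =
      (\<Sum>\<kappa>\<in>hook_level t \<mu> n. real (F t \<kappa> \<mu>) * (G t \<kappa> * q \<kappa>) +
        real (F t \<kappa> \<mu>) * G t \<kappa> * (K + real t * real n))"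
      unfolding sum_hook_level_Suc[OF t]
      by (intro sum.cong refl) (simp only: step(2), simp add: algebra_simps)
    also have "\<dots> = real t * real (n choose 2) + K * real n + q \<mu> + (K + real t * real n)"
      unfolding sum.distrib Suc.IH sum_distrib_right[symmetric] total by simp
    \<comment> \<open>Pascal's rule: \<open>n choose 2\<close> grows by \<open>n\<close>.\<close>
    also have "\<dots> = real t * real (Suc n choose 2) + K * real (Suc n) + q \<mu>"
      by (simp add: numeral_2_eq_2 algebra_simps)
    finally show ?case .
  qed
  then show ?thesis
    unfolding level q_def K_def content_square_sum_def by (simp add: mult.assoc)
qed

end
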